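(* There is an algorithm that, given an $n$-vertex graph $G$ (containing at least one cycle), a parameter $\varepsilon > 0$, and a monotone submodular function $f\colon 2^{V(G)}\rightarrow \mathbb{R}_{\geq 0}$ represented by a value oracle, finds a cycle $C$ in $G$ with $f(V(C))\leq (1+\varepsilon)\cdot {\sf OPT}$ in time $n^{\mathcal{O}(\log 1/\varepsilon)}$.
   Context: Graphs are finite, simple and undirected. A function $f\colon 2^U\to\mathbb{R}$ is submodular if $f(X)+f(Y)\ge f(X\cup Y)+f(X\cap Y)$ for all $X,Y\subseteq U$, and monotone if $f(X)\le f(Y)$ whenever $X\subseteq Y$. The function is given by a value oracle that returns $f(X)$ for any $X\subseteq U$ in unit time; arithmetic on reals takes unit time (real RAM). ${\sf OPT}=\min\{f(V(C))\colon C \text{ is a cycle of } G\}$, which is well defined because $G$ is assumed to contain a cycle. *)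

theory Defs
  imports Complex_Main "Graph_Theory.Pair_Digraph"
begin

section \<open>Cycles and submodular functions\<close>

text \<open>
  A finite simple undirected graph is a \<^locale>\<open>pair_graph\<close>: a finite loop-free digraph
  without parallel arcs whose arc relation is symmetric. In such a digraph the library notion
  \<^const>\<open>pre_digraph.cycle\<close> also covers the closed walk \<open>u, v, u\<close> along a single edge, which is
  not a cycle of an undirected graph. A cycle is therefore given here by the cyclic sequence
  of its vertices, at least three in number.
\<close>

definition is_cycle :: "'a pair_pre_digraph \<Rightarrow> 'a list \<Rightarrow> bool" where
  "is_cycle G C \<longleftrightarrow> 3 \<le> length C \<and> distinct C \<and> set C \<subseteq> pverts G \<and>
     (\<forall>i < length C. (C ! i, C ! (Suc i mod length C)) \<in> parcs G)"

definition submodular_on :: "'a set \<Rightarrow> ('a set \<Rightarrow> real) \<Rightarrow> bool" where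
  "submodular_on U f \<longleftrightarrow> (\<forall>X Y. X \<subseteq> U \<longrightarrow> Y \<subseteq> U \<longrightarrow> f X + f Y \<ge> f (X \<union> Y) + f (X \<inter> Y))"

definition OPT :: "'a pair_pre_digraph \<Rightarrow> ('a set \<Rightarrow> real) \<Rightarrow> real" where
  "OPT G f = Min ((\<lambda>C. f (set C)) ` {C. is_cycle G C})"

text \<open>The minimum ranges over a finite set, so \<^const>\<open>Min\<close> is meaningful as soon as there is a cycle.\<close>

lemma finite_cycles:
  assumes "pair_graph G"
  shows "finite {C. is_cycle G C}"
proof -
  interpret pair_graph G by fact
  have "{C. is_cycle G C} \<subseteq> {C. set C \<subseteq> pverts G \<and> length C \<le> card (pverts G)}"
    by (auto simp: is_cycle_def) (metis card_mono distinct_card pair_finite_verts)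
  then show ?thesis
    using finite_lists_length_le[OF pair_finite_verts] finite_subset by blast
qed

section \<open>A real RAM with a value oracle\<close>

text \<open>
  The machine is programmed in a structured language. A program addresses a fixed number of
  unbounded arrays of natural numbers and of real numbers, named by numerals in the program
  text; indices may be computed, so this is indirect addressing.
  All elementary operations, and a call of the oracle, take one unit of time.

  Multiplication, division and bitwise operations on natural numbers are deliberately left out,
  and there is no rounding from reals to natural numbers: unit-cost arithmetic with these on
  unbounded integers would be unrealistically powerful. The only constants are natural numbers,
  so a program cannot hide information in a real constant.
\<close>

record state =
  imem :: "nat \<Rightarrow> nat \<Rightarrow> nat"
  rmem :: "nat \<Rightarrow> nat \<Rightarrow> real"

datatype iexp =
    INum nat
  | IGet nat iexp
  | IAdd iexp iexp
  | ISub iexp iexp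

datatype rexp =
    RNat iexp
  | RGet nat iexp
  | RAdd rexp rexp
  | RSub rexp rexp
  | RMul rexp rexp
  | RDiv rexp rexp
  | Query nat

datatype bexp =
    ILess iexp iexp
  | RLess rexp rexp
  | BNot bexp
  | BAnd bexp bexp

datatype com =
    Skip
  | ISet nat iexp iexp
  | RSet nat iexp rexp
  | Seq com com
  | If bexp com com
  | While bexp com

primrec ival :: "iexp \<Rightarrow> state \<Rightarrow> nat" where
  "ival (INum k) s = k"
| "ival (IGet a e) s = imem s a (ival e s)"
| "ival (IAdd e1 e2) s = ival e1 s + ival e2 s"
| "ival (ISub e1 e2) s = ival e1 s - ival e2 s"

text \<open>
  The oracle represents \<open>f\<close> on the subsets of \<open>{..<n}\<close>. \<open>Query a\<close> returns the value of the set
  whose characteristic vector is held in the first \<open>n\<close> cells of the integer array \<open>a\<close>.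
\<close>

primrec rval :: "nat \<Rightarrow> (nat set \<Rightarrow> real) \<Rightarrow> rexp \<Rightarrow> state \<Rightarrow> real" where
  "rval n f (RNat e) s = real (ival e s)"
| "rval n f (RGet a e) s = rmem s a (ival e s)"
| "rval n f (RAdd e1 e2) s = rval n f e1 s + rval n f e2 s"
| "rval n f (RSub e1 e2) s = rval n f e1 s - rval n f e2 s"
| "rval n f (RMul e1 e2) s = rval n f e1 s * rval n f e2 s"
| "rval n f (RDiv e1 e2) s = rval n f e1 s / rval n f e2 s"
| "rval n f (Query a) s = f {v. v < n \<and> imem s a v \<noteq> 0}"

primrec bval :: "nat \<Rightarrow> (nat set \<Rightarrow> real) \<Rightarrow> bexp \<Rightarrow> state \<Rightarrow> bool" where
  "bval n f (ILess e1 e2) s \<longleftrightarrow> ival e1 s < ival e2 s"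
| "bval n f (RLess e1 e2) s \<longleftrightarrow> rval n f e1 s < rval n f e2 s"
| "bval n f (BNot b) s \<longleftrightarrow> \<not> bval n f b s"
| "bval n f (BAnd b1 b2) s \<longleftrightarrow> bval n f b1 s \<and> bval n f b2 s"

primrec icost :: "iexp \<Rightarrow> nat" where
  "icost (INum k) = 1"
| "icost (IGet a e) = icost e + 1"
| "icost (IAdd e1 e2) = icost e1 + icost e2 + 1"
| "icost (ISub e1 e2) = icost e1 + icost e2 + 1"

primrec rcost :: "rexp \<Rightarrow> nat" where
  "rcost (RNat e) = icost e + 1"
| "rcost (RGet a e) = icost e + 1"
| "rcost (RAdd e1 e2) = rcost e1 + rcost e2 + 1"
| "rcost (RSub e1 e2) = rcost e1 + rcost e2 + 1"
| "rcost (RMul e1 e2) = rcost e1 + rcost e2 + 1"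
| "rcost (RDiv e1 e2) = rcost e1 + rcost e2 + 1"
| "rcost (Query a) = 1"

primrec bcost :: "bexp \<Rightarrow> nat" where
  "bcost (ILess e1 e2) = icost e1 + icost e2 + 1"
| "bcost (RLess e1 e2) = rcost e1 + rcost e2 + 1"
| "bcost (BNot b) = bcost b + 1"
| "bcost (BAnd b1 b2) = bcost b1 + bcost b2 + 1"

definition iset :: "nat \<Rightarrow> nat \<Rightarrow> nat \<Rightarrow> state \<Rightarrow> state" where
  "iset a i x s = s\<lparr>imem := (imem s)(a := (imem s a)(i := x))\<rparr>"

definition rset :: "nat \<Rightarrow> nat \<Rightarrow> real \<Rightarrow> state \<Rightarrow> state" where
  "rset a i x s = s\<lparr>rmem := (rmem s)(a := (rmem s a)(i := x))\<rparr>"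

text \<open>
  \<open>exec n f c s t s'\<close>: started in \<open>s\<close>, with \<open>f\<close> on the subsets of \<open>{..<n}\<close> as its oracle, the
  program \<open>c\<close> halts in \<open>s'\<close> after exactly \<open>t\<close> units of time.
\<close>

inductive exec :: "nat \<Rightarrow> (nat set \<Rightarrow> real) \<Rightarrow> com \<Rightarrow> state \<Rightarrow> nat \<Rightarrow> state \<Rightarrow> bool"
  for n :: nat and f :: "nat set \<Rightarrow> real" where
  Skip: "exec n f Skip s 1 s"
| ISet: "exec n f (ISet a i e) s (icost i + icost e + 1) (iset a (ival i s) (ival e s) s)"
| RSet: "exec n f (RSet a i e) s (icost i + rcost e + 1) (rset a (ival i s) (rval n f e s) s)"
| Seq: "exec n f c1 s t1 s1 \<Longrightarrow> exec n f c2 s1 t2 s2 \<Longrightarrow> exec n f (Seq c1 c2) s (t1 + t2) s2"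
| IfTrue: "bval n f b s \<Longrightarrow> exec n f c1 s t s1 \<Longrightarrow> exec n f (If b c1 c2) s (bcost b + t + 1) s1"
| IfFalse: "\<not> bval n f b s \<Longrightarrow> exec n f c2 s t s1 \<Longrightarrow> exec n f (If b c1 c2) s (bcost b + t + 1) s1"
| WhileFalse: "\<not> bval n f b s \<Longrightarrow> exec n f (While b c) s (bcost b + 1) s"
| WhileTrue: "bval n f b s \<Longrightarrow> exec n f c s t1 s1 \<Longrightarrow> exec n f (While b c) s1 t2 s2 \<Longrightarrow>
    exec n f (While b c) s (bcost b + t1 + t2 + 1) s2"

text \<open>The machine is deterministic: running time and final state are unique.\<close>

lemma exec_deterministic:
  "exec n f c s t s1 \<Longrightarrow> exec n f c s t' s2 \<Longrightarrow> t' = t \<and> s2 = s1"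
proof (induction arbitrary: t' s2 rule: exec.induct)
  case (Seq c1 s t1 s1 c2 t2 s3)
  from Seq.prems show ?case
    by (cases rule: exec.cases) (use Seq.IH in blast)+
next
  case (WhileTrue b s c t1 s1 u s3)
  from WhileTrue.prems show ?case
    by (cases rule: exec.cases) (use WhileTrue.hyps WhileTrue.IH in blast)+
qed (erule exec.cases; force)+

text \<open>
  Input: the number of vertices, the adjacency matrix in row-major order, and the parameter;
  all other cells hold 0. The function \<open>f\<close> is accessible only through the oracle.
  Output: the length of the vertex sequence, followed by the sequence itself.
\<close>

definition input_state :: "nat \<Rightarrow> nat pair_pre_digraph \<Rightarrow> real \<Rightarrow> state" where
  "input_state n G \<epsilon> = \<lparr>
     imem = (\<lambda>a k.
       if a = 0 \<and> k = 0 then n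
       else if a = 1 \<and> k < n * n \<and> (k div n, k mod n) \<in> parcs G then 1
       else 0),
     rmem = (\<lambda>a k. if a = 0 \<and> k = 0 then \<epsilon> else 0)\<rparr>"

definition output_list :: "state \<Rightarrow> nat list" where
  "output_list s = map (imem s 2) [1..<Suc (imem s 2 0)]"

end

theory Submission
  imports Defs
begin

text \<open>
  Two different paths between the same vertices close a cycle. Let \<open>X\<close> be the part of an optimal
  cycle \<open>C\<close> found so far, ending in \<open>s\<close>, and \<open>r = OPT - f X\<close>. By submodularity, two paths \<open>P\<close>, \<open>Q\<close>
  from \<open>s\<close> with \<open>f (X \<union> P)\<close> and \<open>f (X \<union> Q)\<close> at most \<open>f X + r / 2\<close> satisfy \<open>f (X \<union> P \<union> Q) \<le> OPT\<close>. So
  either two such paths close a cycle of cost at most \<open>OPT\<close>, or these light paths are unique and a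
  Dijkstra-like search from \<open>s\<close> finds all of them. In the second case, guessing the end of the
  longest light continuation of \<open>X\<close> along \<open>C\<close> determines this continuation, and adding the next
  vertex of \<open>C\<close> at least halves \<open>r\<close>. After \<open>log (1 / \<epsilon>)\<close> rounds \<open>r \<le> \<epsilon> OPT\<close>, and a last search in which
  the threshold is \<open>f X + r\<close> finds a cycle of cost at most \<open>OPT + r\<close>. The searches do not depend
  on a threshold, so \<open>OPT\<close> need not be known; the guesses are enumerated as the base \<open>n\<close> digits of
  a counter.
\<close>

section \<open>Cycles and paths\<close>

text \<open>Each round guesses a triple: the vertex \<open>s\<close> at which the search starts and
  two tree ends \<open>u\<close> and \<open>w\<close>. This covers both outcomes:
  \<open>u = w\<close> reproduces the light continuation, while the tree paths to two colliding ends
  together contain the cycle. The machine never learns which outcome occurred. It tries all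
  \<open>n ^ (3 * Suc m)\<close> codes, where \<open>m\<close> is the least number with
  \<open>\<epsilon> * 2 ^ m\<close> at least 1, and the analysis exhibits one good code. A code
  yields a vertex set, not a cycle. Repeatedly deleting vertices of degree below 2 decides whether
  the set contains a cycle, and by monotonicity the set bounds the cost of every cycle inside it.
  Codes are therefore compared by the cost of what remains, bad codes do no harm, and only the best
  remainder is turned into a cycle. For the time bound, every loop is charged with the same number
  \<open>n ^ a\<close> of iterations, where \<open>a = 3 * Suc m\<close> is dictated by the
  enumeration of the codes. The exponent of the total time is then at most \<open>a\<close> times a
  number that depends only on the program text, so the crude bounds on the inner loops cost a
  constant factor in the exponent.\<close>

locale submodular_graph =
  fixes n :: nat and G :: "nat pair_pre_digraph" and f :: "nat set \<Rightarrow> real"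
  assumes pair_graph: "pair_graph G" and verts: "pverts G = {..<n}"
    and submodular: "submodular_on (pverts G) f" and mono_f: "mono_on (Pow (pverts G)) f"
    and nonneg: "X \<subseteq> pverts G \<Longrightarrow> 0 \<le> f X"
begin

abbreviation adj :: "nat \<Rightarrow> nat \<Rightarrow> bool" where
  "adj u v \<equiv> (u, v) \<in> parcs G"

lemma adj_lt: "adj u v \<Longrightarrow> u < n" "adj u v \<Longrightarrow> v < n"
  and adj_sym: "adj u v \<Longrightarrow> adj v u"
  and adj_irrefl: "\<not> adj u u"
proof -
  interpret pair_graph G by (rule pair_graph)
  show "adj u v \<Longrightarrow> u < n" "adj u v \<Longrightarrow> v < n"
    using verts by (auto dest: in_arcsD1 in_arcsD2)
  show "adj u v \<Longrightarrow> adj v u"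
    by (rule arcs_symmetric)
  show "\<not> adj u u"
    using pair_no_loops[of "(u, u)"] by auto
qed

lemma f_mono: "X \<subseteq> Y \<Longrightarrow> Y \<subseteq> {..<n} \<Longrightarrow> f X \<le> f Y"
  using mono_f verts by (auto intro: mono_onD)

lemma f_nonneg: "X \<subseteq> {..<n} \<Longrightarrow> 0 \<le> f X"
  using nonneg verts by auto

text \<open>The intersection still contains \<open>X\<close>, so the value that submodularity
  subtracts is at least \<open>f X\<close> by monotonicity. If \<open>f A\<close> and
  \<open>f B\<close> are at most \<open>\<theta>\<close>, the bound becomes
  \<open>2 * \<theta> - f X\<close>.\<close>

lemma f_union_le:
  assumes "X \<subseteq> A" "X \<subseteq> B" "A \<subseteq> {..<n}" "B \<subseteq> {..<n}"
  shows "f (A \<union> B) \<le> f A + f B - f X"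
proof -
  have "f (A \<union> B) + f (A \<inter> B) \<le> f A + f B"
    using submodular assms verts by (auto simp: submodular_on_def)
  moreover have "f X \<le> f (A \<inter> B)"
    using assms by (intro f_mono) auto
  ultimately show ?thesis by linarith
qed

definition has_cycle :: "nat set \<Rightarrow> bool" where
  "has_cycle Y \<longleftrightarrow> (\<exists>C. is_cycle G C \<and> set C \<subseteq> Y)"

lemma has_cycle_mono: "has_cycle X \<Longrightarrow> X \<subseteq> Y \<Longrightarrow> has_cycle Y"
  unfolding has_cycle_def by blast

lemma is_cycleI:
  assumes "3 \<le> length C" "distinct C" "successively adj C" "adj (last C) (hd C)"
  shows "is_cycle G C"
proof -
  have arcs: "adj (C ! i) (C ! (Suc i mod length C))" if "i < length C" for i
  proof (cases "Suc i < length C")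
    case True
    then show ?thesis using assms(3) by (simp add: successively_conv_nth)
  next
    case False
    then have "Suc i = length C" using that by simp
    then have "Suc i mod length C = 0" "C ! i = last C" "C ! 0 = hd C"
      by (auto simp: last_conv_nth hd_conv_nth) (metis diff_Suc_1 last_conv_nth list.size(3) nat.distinct(1), metis hd_conv_nth list.size(3) nat.distinct(1))
    then show ?thesis using assms(4) by simp
  qed
  have "x < n" if "x \<in> set C" for x
    using that arcs adj_lt by (metis in_set_conv_nth)
  then show ?thesis
    using assms arcs verts by (auto simp: is_cycle_def)
qed

lemma is_cycleD:
  assumes "is_cycle G C"
  shows "3 \<le> length C" "distinct C" "set C \<subseteq> {..<n}" "successively adj C"
proof -
  show "3 \<le> length C" "distinct C" "set C \<subseteq> {..<n}"
    using assms verts by (auto simp: is_cycle_def)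
  show "successively adj C"
    unfolding successively_conv_nth
  proof (intro allI impI)
    fix i assume "Suc i < length C"
    then show "adj (C ! i) (C ! Suc i)"
      using assms unfolding is_cycle_def by (metis Suc_lessD mod_less)
  qed
qed

definition spath :: "nat \<Rightarrow> nat list \<Rightarrow> nat \<Rightarrow> bool" where
  "spath s P v \<longleftrightarrow> P \<noteq> [] \<and> hd P = s \<and> last P = v \<and> distinct P \<and> successively adj P
     \<and> set P \<subseteq> {..<n}"

lemma successively_adj_rev: "successively adj (rev P) \<longleftrightarrow> successively adj P"
  unfolding successively_rev by (rule arg_cong2[where f = successively]) (auto intro!: ext adj_sym)

text \<open>Common initial vertices are stripped by induction. Where the paths diverge after
  \<open>z\<close>, following \<open>P\<close> to its first vertex \<open>x\<close> on
  \<open>Q'\<close> and returning along \<open>Q'\<close> closes a simple cycle; the common end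
  \<open>v\<close> ensures that \<open>x\<close> exists.\<close>

lemma cycle_of_two_paths:
  assumes "spath s P v" "spath s Q v" "P \<noteq> Q"
  shows "has_cycle (set P \<union> set Q)"
  using assms
proof (induction P arbitrary: s Q)
  case Nil
  then show ?case by (simp add: spath_def)
next
  case (Cons z P)
  then have z: "z = s" by (simp add: spath_def)
  from Cons.prems obtain Q' where Q: "Q = z # Q'"
    by (cases Q) (auto simp: spath_def)
  have ne: "P \<noteq> []" "Q' \<noteq> []"
    using Cons.prems z Q by (auto simp: spath_def split: if_splits)
  have P: "distinct P" "successively adj P" "adj z (hd P)" "z \<notin> set P" "last P = v" "set P \<subseteq> {..<n}"
    using Cons.prems(1) ne by (auto simp: spath_def successively_Cons)
  have Q': "distinct Q'" "successively adj Q'" "adj z (hd Q')" "z \<notin> set Q'" "last Q' = v"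
      "set Q' \<subseteq> {..<n}"
    using Cons.prems(2) ne Q by (auto simp: spath_def successively_Cons)
  show ?case
  proof (cases "hd P = hd Q'")
    case True
    have "has_cycle (set P \<union> set Q')"
      by (rule Cons.IH[of "hd P"]) (use P Q' ne True Cons.prems(3) Q in \<open>auto simp: spath_def\<close>)
    then show ?thesis
      by (rule has_cycle_mono) (auto simp: Q)
  next
    case False
    have "\<exists>x\<in>set P. x \<in> set Q'"
      using P(5) Q'(5) ne by (metis last_in_set)
    then obtain P1 x P2 where x: "P = P1 @ x # P2" "x \<in> set Q'" "\<forall>y\<in>set P1. y \<notin> set Q'"
      using split_list_first_prop[of P "\<lambda>y. y \<in> set Q'"] by blast
    then obtain Q1 Q2 where Q1: "Q' = Q1 @ x # Q2"
      using split_list by metis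
    let ?C = "z # P1 @ x # rev Q1"
    \<comment> \<open>If both were empty, \<open>P\<close> and \<open>Q'\<close> would both start
      with \<open>x\<close>. This provides the third vertex of the cycle.\<close>
    have "P1 \<noteq> [] \<or> Q1 \<noteq> []"
      using False x Q1 by auto
    then have "3 \<le> length ?C"
      by (cases P1; cases Q1) auto
    moreover have "distinct ?C"
      using P(1,4) Q'(1,4) x Q1 by auto
    moreover have "successively adj ((z # P1 @ [x]) @ P2)"
      using Cons.prems(1) x(1) by (auto simp: spath_def)
    then have "successively adj (z # P1 @ [x])"
      unfolding successively_append_iff[of _ _ P2] by blast
    moreover have "successively adj ((z # Q1 @ [x]) @ Q2)"
      using Cons.prems(2) Q Q1 by (auto simp: spath_def)
    then have "successively adj (z # Q1 @ [x])"
      unfolding successively_append_iff[of _ _ Q2] by blast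
    then have "successively adj (rev (z # Q1 @ [x]))"
      by (simp only: successively_adj_rev)
    then have "successively adj (x # rev Q1 @ [z])"
      by simp
    ultimately have "is_cycle G ?C"
      by (intro is_cycleI)
        (auto simp: successively_append_iff successively_Cons last_rev hd_rev hd_append split: if_splits)
    moreover have "set ?C \<subseteq> set (z # P) \<union> set Q"
      using x(1) Q Q1 by auto
    ultimately show ?thesis
      unfolding has_cycle_def by blast
  qed
qed

section \<open>Growing a tree of cheap paths\<close>

text \<open>Scores are positive, so a memory cell that still holds 0 means that nothing was found yet.\<close>

definition score :: "nat set \<Rightarrow> real" where
  "score Y = 1 / (1 + f Y)"

lemma score_pos: "Y \<subseteq> {..<n} \<Longrightarrow> 0 < score Y"
  using f_nonneg[of Y] by (simp add: score_def)

lemma score_le_iff: "Y \<subseteq> {..<n} \<Longrightarrow> Z \<subseteq> {..<n} \<Longrightarrow> score Y \<le> score Z \<longleftrightarrow> f Z \<le> f Y"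
  using f_nonneg[of Y] f_nonneg[of Z] by (simp add: score_def field_simps)

definition valid :: "nat set \<Rightarrow> nat \<Rightarrow> nat \<Rightarrow> bool" where
  "valid D u v \<longleftrightarrow> u \<in> D \<and> adj u v \<and> v \<notin> D"

definition select1 :: "nat set \<Rightarrow> nat set \<Rightarrow> (nat \<Rightarrow> nat set) \<Rightarrow> nat \<Rightarrow> nat \<Rightarrow>
    nat \<times> nat \<times> real \<Rightarrow> nat \<times> nat \<times> real" where
  "select1 X D p u v acc = (let c = score (X \<union> p u \<union> {v}) in
     if valid D u v \<and> snd (snd acc) < c then (u, v, c) else acc)"

definition select :: "nat set \<Rightarrow> nat set \<Rightarrow> (nat \<Rightarrow> nat set) \<Rightarrow> nat \<times> nat \<times> real" where
  "select X D p = fold (\<lambda>u. fold (select1 X D p u) [0..<n]) [0..<n] (0, 0, 0)"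

text \<open>Dijkstra's step with vertex sets in place of distances: \<open>f\<close> is not additive
  along a path, so the whole path \<open>p u\<close> is needed to price an extension.\<close>

definition grow :: "nat set \<Rightarrow> nat set \<times> (nat \<Rightarrow> nat set) \<Rightarrow> nat set \<times> (nat \<Rightarrow> nat set)" where
  "grow X = (\<lambda>(D, p). case select X D p of (u, v, c) \<Rightarrow>
     if 0 < c then (insert v D, p(v := insert v (p u))) else (D, p))"

definition tree :: "nat \<Rightarrow> nat set \<Rightarrow> nat set \<times> (nat \<Rightarrow> nat set)" where
  "tree s X = (grow X ^^ n) ({s}, (\<lambda>_. {})(s := {s}))"

lemma select_props:
  assumes p: "\<And>u. u \<in> D \<Longrightarrow> p u \<subseteq> {..<n}" and X: "X \<subseteq> {..<n}"
    and sel: "select X D p = (u, v, c)"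
  shows "0 < c \<Longrightarrow> valid D u v"
    and "0 < c \<Longrightarrow> valid D u' v' \<Longrightarrow> f (X \<union> p u \<union> {v}) \<le> f (X \<union> p u' \<union> {v'})"
    and "\<not> 0 < c \<Longrightarrow> \<not> valid D u' v'"
proof -
  \<comment> \<open>\<open>S\<close> collects the pairs scanned so far; the nested folds enlarge it
    row by row. Maximal score means minimal cost, since \<open>score\<close> decreases in
    \<open>f\<close>.\<close>
  define good :: "(nat \<times> nat) set \<Rightarrow> nat \<times> nat \<times> real \<Rightarrow> bool" where
    "good S = (\<lambda>(u, v, c). (c = 0 \<or> valid D u v \<and> c = score (X \<union> p u \<union> {v})) \<and>
       (\<forall>(u', v')\<in>S. valid D u' v' \<longrightarrow> score (X \<union> p u' \<union> {v'}) \<le> c))" for S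
  have sub: "X \<union> p u \<union> {v} \<subseteq> {..<n}" if "valid D u v" for u v
    using that p X adj_lt(2) unfolding valid_def by blast
  have step: "good (insert (u, v) S) (select1 X D p u v acc)" if "good S acc" for u v S acc
    using that score_pos[OF sub, of u v] by (auto simp: good_def select1_def Let_def split: prod.splits)
  have inner: "good (S \<union> {u} \<times> {..<m}) (fold (select1 X D p u) [0..<m] acc)" if "good S acc" for u S acc m
  proof (induction m)
    case 0 then show ?case using that by simp
  next
    case (Suc m)
    from step[OF this, of u m] show ?case
      by (simp add: lessThan_Suc)
  qed
  have outer: "good ({..<m} \<times> {..<n}) (fold (\<lambda>u. fold (select1 X D p u) [0..<n]) [0..<m] (0, 0, 0))" for m
  proof (induction m)
    case 0 then show ?case by (simp add: good_def)
  next
    case (Suc m)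
    have "{..<Suc m} \<times> {..<n} = {..<m} \<times> {..<n} \<union> {m} \<times> {..<n}" by auto
    then show ?case using inner[OF Suc, of m n] by simp
  qed
  have g: "good ({..<n} \<times> {..<n}) (u, v, c)"
    using outer[of n] sel by (simp add: select_def)
  have le: "score (X \<union> p u' \<union> {v'}) \<le> c" if "valid D u' v'" for u' v'
    using g that adj_lt[of u' v'] by (auto simp: good_def valid_def)
  show 1: "valid D u v" if "0 < c"
    using g that by (auto simp: good_def)
  show "f (X \<union> p u \<union> {v}) \<le> f (X \<union> p u' \<union> {v'})" if "0 < c" "valid D u' v'"
    using le[OF that(2)] score_le_iff[OF sub[OF that(2)] sub[OF 1[OF that(1)]]] g that(1)
    by (auto simp: good_def)
  show "\<not> valid D u' v'" if "\<not> 0 < c"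
    using le[of u' v'] score_pos[OF sub, of u' v'] that by auto
qed

text \<open>The last two conjuncts are Dijkstra's invariant: no tree neighbour offers a cheaper last
  step, and vertices enter in order of cost. The second keeps the first alive when a new vertex
  becomes a possible predecessor of older ones.\<close>

definition tree_inv :: "nat \<Rightarrow> nat set \<Rightarrow> nat set \<Rightarrow> (nat \<Rightarrow> nat set) \<Rightarrow> bool" where
  "tree_inv s X D p \<longleftrightarrow> s \<in> D \<and> D \<subseteq> {..<n} \<and> p s = {s} \<and>
     (\<forall>v\<in>D. p v \<subseteq> D \<and> (\<exists>P. spath s P v \<and> set P = p v)) \<and>
     (\<forall>u\<in>D. \<forall>v\<in>D. adj u v \<longrightarrow> f (X \<union> p v) \<le> f (X \<union> p u \<union> {v})) \<and>
     (\<forall>w\<in>D. \<forall>u\<in>D. \<forall>v. v \<notin> D \<and> adj u v \<longrightarrow> f (X \<union> p w) \<le> f (X \<union> p u \<union> {v}))"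

lemma tree_inv_path: "tree_inv s X D p \<Longrightarrow> v \<in> D \<Longrightarrow> \<exists>P. spath s P v \<and> set P = p v"
  by (simp add: tree_inv_def)

lemma spath_subset: "spath s P v \<Longrightarrow> set P \<subseteq> {..<n}"
  by (simp add: spath_def)

lemma spath_snoc:
  "spath s P u \<Longrightarrow> adj u v \<Longrightarrow> v \<notin> set P \<Longrightarrow> spath s (P @ [v]) v"
  using adj_lt by (auto simp: spath_def successively_append_iff)

text \<open>The chosen pair is cheapest on the frontier, and monotonicity makes each further
  extension at least as expensive. The second claim feeds the count showing that \<open>n\<close>
  rounds suffice.\<close>

lemma tree_inv_grow:
  assumes X: "X \<subseteq> {..<n}" and inv: "tree_inv s X D p" and g: "grow X (D, p) = (D', p')"
  shows "tree_inv s X D' p'"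
    and "(\<forall>u v. \<not> valid D u v) \<and> D' = D \<or> (\<exists>u v. valid D u v) \<and> card D' = Suc (card D)"
proof -
  obtain u0 v0 c where sel: "select X D p = (u0, v0, c)"
    by (cases "select X D p") auto
  have paths: "\<And>v. v \<in> D \<Longrightarrow> \<exists>P. spath s P v \<and> set P = p v"
    and sD: "s \<in> D" and Dn: "D \<subseteq> {..<n}" and ps: "p s = {s}"
    and I1: "\<And>u v. u \<in> D \<Longrightarrow> v \<in> D \<Longrightarrow> adj u v \<Longrightarrow> f (X \<union> p v) \<le> f (X \<union> p u \<union> {v})"
    and I2: "\<And>w u v. w \<in> D \<Longrightarrow> u \<in> D \<Longrightarrow> v \<notin> D \<Longrightarrow> adj u v \<Longrightarrow> f (X \<union> p w) \<le> f (X \<union> p u \<union> {v})"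
    using inv unfolding tree_inv_def by blast+
  have pD: "p v \<subseteq> D" if "v \<in> D" for v
    using inv that unfolding tree_inv_def by blast
  have pn: "p v \<subseteq> {..<n}" if "v \<in> D" for v
    using pD[OF that] Dn by blast
  note props = select_props[where D = D and p = p, OF _ X sel, OF pn]
  have "tree_inv s X D' p' \<and> ((\<forall>u v. \<not> valid D u v) \<and> D' = D \<or>
      (\<exists>u v. valid D u v) \<and> card D' = Suc (card D))"
  proof (cases "0 < c")
    case False
    then show ?thesis
      using g sel inv props(3) by (auto simp: grow_def)
  next
    case True
    then have D': "D' = insert v0 D" and p': "p' = p(v0 := insert v0 (p u0))"
      using g sel by (auto simp: grow_def)
    from props(1)[OF _ True] have v0: "u0 \<in> D" "adj u0 v0" "v0 \<notin> D"
      by (auto simp: valid_def)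
    have min: "f (X \<union> p' v0) \<le> f (X \<union> p u \<union> {v})" if "u \<in> D" "adj u v" "v \<notin> D" for u v
      using props(2)[OF _ True, of u v] that by (auto simp: valid_def p')
    have p'D: "p' v = p v" if "v \<in> D" for v
      using that v0 p' by auto
    obtain P where P: "spath s P u0" "set P = p u0"
      using paths[OF v0(1)] by blast
    have "v0 \<notin> set P"
      using P(2) pD v0 by blast
    then have path0: "spath s (P @ [v0]) v0" "set (P @ [v0]) = p' v0"
      using spath_snoc[OF P(1) v0(2)] P(2) by (auto simp: p')
    have pv0: "p' v0 \<subseteq> D'"
      using pD[OF v0(1)] by (auto simp: p' D')
    have v0_le: "f (X \<union> p' v0) \<le> f (X \<union> p' v0 \<union> {v})" if "v < n" for v
      using X that pv0 Dn v0 adj_lt D' by (intro f_mono) auto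
    have le_v0: "f (X \<union> p w) \<le> f (X \<union> p' v0)" if "w \<in> D" for w
      using I2[OF that v0(1,3,2)] by (simp add: p')
    have "\<forall>v\<in>D'. p' v \<subseteq> D' \<and> (\<exists>P. spath s P v \<and> set P = p' v)"
    proof
      fix v assume "v \<in> D'"
      then consider "v = v0" | "v \<in> D" using D' by auto
      then show "p' v \<subseteq> D' \<and> (\<exists>P. spath s P v \<and> set P = p' v)"
      proof cases
        case 1
        then show ?thesis using path0 pv0 by blast
      next
        case 2
        then show ?thesis using pD[OF 2] paths[OF 2] p'D[OF 2] D' by auto
      qed
    qed
    moreover have "f (X \<union> p' v) \<le> f (X \<union> p' u \<union> {v})" if uv: "u \<in> D'" "v \<in> D'" "adj u v" for u v
    proof (cases "u \<in> D")
      case True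
      then show ?thesis
        using uv I1[of u v] min[of u v] p'D v0(3) D' by (cases "v \<in> D") auto
    next
      case False
      \<comment> \<open>An arc from the new vertex back to an older \<open>v\<close>: since
        \<open>v\<close> entered earlier, its path costs at most as much as \<open>p' v0\<close>,
        and adding \<open>v\<close> cannot lower that cost.\<close>
      then have "u = v0" "v \<in> D"
        using uv D' adj_irrefl by auto
      then show ?thesis
        using le_v0[of v] v0_le[of v] p'D adj_lt(2)[OF uv(3)] by auto
    qed
    moreover have "f (X \<union> p' w) \<le> f (X \<union> p' u \<union> {v})"
      if uv: "w \<in> D'" "u \<in> D'" "v \<notin> D'" "adj u v" for w u v
    proof -
      have "f (X \<union> p' w) \<le> f (X \<union> p' v0)"
        using uv(1) le_v0 p'D D' by auto
      also have "\<dots> \<le> f (X \<union> p' u \<union> {v})"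
        using uv min[of u v] v0_le[OF adj_lt(2)[OF uv(4)]] p'D D' by (cases "u = v0") auto
      finally show ?thesis .
    qed
    moreover have "p' s = {s}"
      using ps p'D sD by simp
    moreover have "D' \<subseteq> {..<n}" "s \<in> D'"
      using Dn sD v0 adj_lt D' by auto
    moreover have "card D' = Suc (card D)"
      using v0(3) finite_subset[OF Dn] by (simp add: D')
    ultimately show ?thesis
      using props(1)[OF _ True] unfolding tree_inv_def by blast
  qed
  then show "tree_inv s X D' p'"
    and "(\<forall>u v. \<not> valid D u v) \<and> D' = D \<or> (\<exists>u v. valid D u v) \<and> card D' = Suc (card D)" by auto
qed

lemma tree_props:
  assumes X: "X \<subseteq> {..<n}" and s: "s \<in> X" and t: "tree s X = (D, p)"
  shows "tree_inv s X D p" and "\<not> valid D u v"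
proof -
  define T0 where "T0 = ({s}, (\<lambda>_. {})(s := {s}))"
  \<comment> \<open>Each round with a nonempty frontier adds a vertex to the initial
    \<open>{s}\<close>. At \<open>i = n\<close> the second alternative is impossible, so the
    frontier is empty.\<close>
  have *: "tree_inv s X (fst T) (snd T) \<and> ((\<forall>u v. \<not> valid (fst T) u v) \<or> i < card (fst T))"
    if "T = (grow X ^^ i) T0" for T i
    using that
  proof (induction i arbitrary: T)
    case 0
    let ?p = "(\<lambda>_. {})(s := {s})"
    have "tree_inv s X {s} ?p"
      unfolding tree_inv_def
    proof (intro conjI ballI allI impI)
      show "{s} \<subseteq> {..<n}" using X s by auto
      show "\<exists>P. spath s P v \<and> set P = ?p v" if "v \<in> {s}" for v
        using X s that by (intro exI[of _ "[s]"]) (auto simp: spath_def)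
      show "f (X \<union> ?p v) \<le> f (X \<union> ?p u \<union> {v})" if "u \<in> {s}" "v \<in> {s}" "adj u v" for u v
        using that adj_irrefl by simp
      show "f (X \<union> ?p w) \<le> f (X \<union> ?p u \<union> {v})"
        if "w \<in> {s}" "u \<in> {s}" "v \<notin> {s} \<and> adj u v" for w u v
        using that X s adj_lt(2)[of u v] by (intro f_mono) auto
    qed auto
    then show ?case
      using 0 by (simp add: T0_def del: fun_upd_apply)
  next
    case (Suc i)
    obtain D p where Dp: "(grow X ^^ i) T0 = (D, p)"
      by fastforce
    obtain D' p' where T: "T = (D', p')" by fastforce
    have g: "grow X (D, p) = (D', p')"
      using Suc.prems T Dp by simp
    have IH: "tree_inv s X D p" "(\<forall>u v. \<not> valid D u v) \<or> i < card D"
      using Suc.IH[OF refl] Dp by auto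
    have "(\<forall>u v. \<not> valid D' u v) \<or> Suc i < card D'"
      using tree_inv_grow(2)[OF X IH(1) g] IH(2) by auto
    then show ?case
      using tree_inv_grow(1)[OF X IH(1) g] T by simp
  qed
  have 1: "tree_inv s X D p" "(\<forall>u v. \<not> valid D u v) \<or> n < card D"
    using *[of "(D, p)" n] t by (auto simp: tree_def T0_def)
  then have "card D \<le> n"
    using card_mono[of "{..<n}" D] by (auto simp: tree_inv_def)
  then show "tree_inv s X D p" "\<not> valid D u v"
    using 1 by auto
qed

text \<open>Induction along \<open>P\<close>, whose initial segments are light by monotonicity. If
  the tree agrees with \<open>P\<close> up to \<open>u\<close>, its path to \<open>v\<close> costs
  at most as much as \<open>P\<close> up to \<open>v\<close>. If that path differs from
  \<open>P\<close>, the two close a cycle.\<close>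

lemma light_path_or_collision:
  assumes X: "X \<subseteq> {..<n}" and s: "s \<in> X" and t: "tree s X = (D, p)"
    and P: "spath s P v" "f (X \<union> set P) \<le> \<theta>"
  shows "v \<in> D \<and> p v = set P \<or>
    (\<exists>u\<in>D. \<exists>w\<in>D. has_cycle (p u \<union> p w) \<and> f (X \<union> p u) \<le> \<theta> \<and> f (X \<union> p w) \<le> \<theta>)"
  using P
proof (induction P arbitrary: v rule: rev_induct)
  case Nil
  then show ?case by (simp add: spath_def)
next
  case (snoc x P)
  note inv = tree_props(1)[OF X s t]
  have x: "x = v" using snoc.prems by (simp add: spath_def)
  show ?case
  proof (cases "P = []")
    case True
    then show ?thesis
      using snoc.prems inv by (auto simp: spath_def tree_inv_def)
  next
    case False
    define u where "u = last P"
    have P: "spath s P u" "adj u v" "v \<notin> set P"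
      using snoc.prems(1) False by (auto simp: spath_def u_def successively_append_iff)
    have "set (P @ [x]) \<subseteq> {..<n}"
      using snoc.prems(1) spath_subset by blast
    then have "f (X \<union> set P) \<le> f (X \<union> set (P @ [x]))"
      using X by (intro f_mono) auto
    then have Ple: "f (X \<union> set P) \<le> \<theta>"
      using snoc.prems(2) by linarith
    show ?thesis
    proof (cases "u \<in> D \<and> p u = set P")
      case False
      then show ?thesis using snoc.IH[OF P(1) Ple] by blast
    next
      case True
      then have v: "v \<in> D"
        using tree_props(2)[OF X s t, of u v] P(2) by (auto simp: valid_def)
      then have "f (X \<union> p v) \<le> f (X \<union> p u \<union> {v})"
        using inv True P(2) unfolding tree_inv_def by blast
      also have "X \<union> p u \<union> {v} = X \<union> set (P @ [x])"
        using True x by auto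
      finally have le: "f (X \<union> p v) \<le> \<theta>"
        using snoc.prems(2) by linarith
      obtain Q where Q: "spath s Q v" "set Q = p v"
        using tree_inv_path[OF inv v] by blast
      show ?thesis
      proof (cases "Q = P @ [x]")
        case True
        then show ?thesis using v Q by simp
      next
        case False
        then have "has_cycle (set Q \<union> set (P @ [x]))"
          using Q(1) snoc.prems(1) by (intro cycle_of_two_paths[of s _ v]) auto
        \<comment> \<open>\<open>p u\<close> is all of the given path except \<open>v\<close>, and
          \<open>v\<close> ends \<open>Q\<close>; hence two tree paths, both light, cover the
          cycle.\<close>
        moreover have "set Q \<union> set (P @ [x]) = p v \<union> p u"
          using Q True x by (auto simp: spath_def)
        ultimately show ?thesis
          using True v le Ple by metis
      qed
    qed
  qed
qed

section \<open>Halving the missing cost\<close>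

text \<open>In a good code \<open>s\<close> is the vertex of the optimal cycle that follows the part
  held in \<open>X\<close>; it is added before the search, so light paths are priced relative to
  \<open>insert s X\<close>.\<close>

definition extend :: "nat \<Rightarrow> nat \<Rightarrow> nat \<Rightarrow> nat set \<Rightarrow> nat set" where
  "extend s u w X = (let p = snd (tree s (insert s X)) in insert s X \<union> p u \<union> p w)"

primrec run :: "nat \<Rightarrow> nat \<Rightarrow> nat set \<Rightarrow> nat set" where
  "run 0 c X = X"
| "run (Suc k) c X =
     run k (c div n div n div n) (extend (c mod n) (c div n mod n) (c div n div n mod n) X)"

text \<open>Lets a good code be assembled from the last round back to the first: the new triple
  becomes the three least significant base \<open>n\<close> digits.\<close>

lemma run_Suc_code:
  assumes "s < n" "u < n" "w < n" "c < n ^ (3 * k)"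
  shows "\<exists>c' < n ^ (3 * Suc k). run (Suc k) c' X = run k c (extend s u w X)"
proof -
  let ?c = "s + n * (u + n * (w + n * c))"
  have n: "0 < n" using assms by simp
  have lt: "a + n * b < n * N" if "a < n" "b < N" for a b N :: nat
  proof -
    have "a + n * b < n * Suc b" using that by simp
    also have "\<dots> \<le> n * N" using that by (intro mult_le_mono2) simp
    finally show ?thesis .
  qed
  have "?c < n * (n * (n * n ^ (3 * k)))"
    using assms by (intro lt)
  also have "n * (n * (n * n ^ (3 * k))) = n ^ (3 * Suc k)"
    by (simp add: power_add power3_eq_cube ac_simps)
  finally have "?c < n ^ (3 * Suc k)" .
  moreover have "run (Suc k) ?c X = run k c (extend s u w X)"
    using assms n by simp
  ultimately show ?thesis by blast
qed

text \<open>\<open>tree_inv\<close> describes only the rows of tree vertices, whereas an arbitrary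
  code may name ends outside the tree. Hence the induction over all rows, which makes the candidates
  of bad codes vertex sets as well.\<close>

lemma run_subset:
  assumes "0 < n" "X \<subseteq> {..<n}"
  shows "run k c X \<subseteq> {..<n}"
  using assms(2)
proof (induction k arbitrary: c X)
  case (Suc k)
  have grow: "snd (grow Y (D, p)) v \<subseteq> {..<n}" if "Y \<subseteq> {..<n}" "\<And>v. p v \<subseteq> {..<n}" for Y D p v
  proof -
    obtain u w r where sel: "select Y D p = (u, w, r)" by (cases "select Y D p") auto
    have "w < n" if "0 < r"
      using select_props(1)[OF _ \<open>Y \<subseteq> {..<n}\<close> sel that] \<open>\<And>v. p v \<subseteq> {..<n}\<close> adj_lt by (auto simp: valid_def)
    then show ?thesis using that(2) by (auto simp: grow_def sel)
  qed
  have tree: "snd (tree s Y) v \<subseteq> {..<n}" if Y: "Y \<subseteq> {..<n}" and s: "s < n" for s Y v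
  proof -
    have "snd ((grow Y ^^ i) ({s}, (\<lambda>_. {})(s := {s}))) v \<subseteq> {..<n}" for i v
    proof (induction i arbitrary: v)
      case 0
      then show ?case using s by simp
    next
      case (Suc i)
      then show ?case
        using grow[OF Y, of "snd ((grow Y ^^ i) ({s}, (\<lambda>_. {})(s := {s})))"
            "fst ((grow Y ^^ i) ({s}, (\<lambda>_. {})(s := {s})))" v]
        by (simp del: fun_upd_apply)
    qed
    then show ?thesis by (simp add: tree_def del: fun_upd_apply)
  qed
  have "extend s u w X \<subseteq> {..<n}" if "s < n" for s u w
    using tree[of "insert s X" s] that Suc.prems by (simp add: extend_def Let_def)
  then show ?case
    using Suc.IH assms(1) by simp
qed simp

text \<open>Pads the code when a cycle is found early: a start in \<open>X\<close> with both ends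
  equal to it adds only the root path \<open>{s}\<close>.\<close>

lemma run_idle:
  assumes "X \<subseteq> {..<n}" "s \<in> X"
  shows "\<exists>c < n ^ (3 * k). run k c X = X"
proof (induction k)
  case 0
  then show ?case by auto
next
  case (Suc k)
  obtain D p where t: "tree s X = (D, p)" by fastforce
  have "p s = {s}"
    using tree_props(1)[OF assms t] by (simp add: tree_inv_def)
  then have "extend s s s X = X"
    using assms t by (auto simp: extend_def insert_absorb)
  moreover obtain c where "c < n ^ (3 * k)" "run k c X = X"
    using Suc by blast
  ultimately show ?case
    using run_Suc_code[of s s s c k X] assms by auto
qed

text \<open>If the tree deviates from \<open>P\<close>, submodularity bounds the union of the two
  colliding light paths. The fact \<open>s \<in> extend s u w X\<close> is recorded so that the
  remaining rounds can idle at \<open>s\<close>.\<close>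

lemma extend_light:
  assumes X: "X \<subseteq> {..<n}" and P: "spath s P v" "f (insert s X \<union> set P) \<le> \<theta>"
  shows "extend s v v X = insert s X \<union> set P \<or>
    (\<exists>u<n. \<exists>w<n. has_cycle (extend s u w X) \<and> s \<in> extend s u w X \<and> extend s u w X \<subseteq> {..<n} \<and>
      f (extend s u w X) \<le> 2 * \<theta> - f (insert s X))"
proof -
  let ?X = "insert s X"
  obtain D p where t: "tree s ?X = (D, p)" by fastforce
  have sn: "s < n" using P(1) unfolding spath_def by (metis hd_in_set lessThan_iff subsetD)
  have X': "?X \<subseteq> {..<n}" using X sn by simp
  have ext: "extend s u w X = ?X \<union> p u \<union> p w" for u w
    by (simp add: extend_def t Let_def)
  have inv: "tree_inv s ?X D p"
    by (rule tree_props[OF X' _ t]) simp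
  have "v \<in> D \<and> p v = set P \<or>
      (\<exists>u\<in>D. \<exists>w\<in>D. has_cycle (p u \<union> p w) \<and> f (?X \<union> p u) \<le> \<theta> \<and> f (?X \<union> p w) \<le> \<theta>)"
    by (rule light_path_or_collision[OF X' _ t P]) simp
  then show ?thesis
  proof (elim disjE bexE conjE)
    assume "p v = set P"
    then show ?thesis using ext by auto
  next
    fix u w assume uw: "u \<in> D" "w \<in> D" "has_cycle (p u \<union> p w)"
      "f (?X \<union> p u) \<le> \<theta>" "f (?X \<union> p w) \<le> \<theta>"
    have sub: "D \<subseteq> {..<n}" "p u \<subseteq> D" "p w \<subseteq> D"
      using inv uw(1,2) by (auto simp: tree_inv_def)
    have "f ((?X \<union> p u) \<union> (?X \<union> p w)) \<le> f (?X \<union> p u) + f (?X \<union> p w) - f ?X"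
      using X' sub by (intro f_union_le) auto
    also have "(?X \<union> p u) \<union> (?X \<union> p w) = extend s u w X"
      by (auto simp: ext)
    finally have "f (extend s u w X) \<le> 2 * \<theta> - f ?X"
      using uw by linarith
    moreover have "has_cycle (extend s u w X)"
      by (rule has_cycle_mono[OF uw(3)]) (auto simp: ext)
    moreover have "extend s u w X \<subseteq> {..<n}" "s \<in> extend s u w X"
      using sub X' by (auto simp: ext)
    ultimately show ?thesis
      using uw sub by blast
  qed
qed

lemma longest_prefix:
  assumes "Q []"
  obtains B1 B2 where "B = B1 @ B2" "Q B1" "\<And>x B3. B2 = x # B3 \<Longrightarrow> \<not> Q (B1 @ [x])"
proof -
  have "\<exists>B1 B2. B = B1 @ B2 \<and> Q B1 \<and> (\<forall>x B3. B2 = x # B3 \<longrightarrow> \<not> Q (B1 @ [x]))"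
  proof (induction B rule: rev_induct)
    case Nil
    then show ?case using assms by auto
  next
    case (snoc y B)
    then obtain B1 B2 where B: "B = B1 @ B2" "Q B1" "\<forall>x B3. B2 = x # B3 \<longrightarrow> \<not> Q (B1 @ [x])"
      by blast
    show ?case
    proof (cases "B2 = [] \<and> Q (B1 @ [y])")
      case True
      then show ?thesis using B by (intro exI[of _ "B1 @ [y]"] exI[of _ "[]"]) auto
    next
      case False
      then show ?thesis
        using B by (intro exI[of _ B1] exI[of _ "B2 @ [y]"]) (auto simp: append_eq_Cons_conv)
    qed
  qed
  then show thesis using that by blast
qed

text \<open>\<open>A @ [s]\<close> is the part of the cycle already secured and \<open>r\<close> the
  missing cost. The form \<open>insert s X\<close> admits both \<open>X = {}\<close> at the start
  and a later \<open>X\<close> that lacks the next vertex. Of the \<open>Suc j\<close> rounds,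
  \<open>j\<close> halve \<open>r\<close>, and the last one loses at most what then remains.\<close>

lemma run_finds_cycle:
  assumes C: "is_cycle G (A @ s # B)" and X: "insert s X = set (A @ [s])"
    and r: "r = f (set (A @ s # B)) - f (set (A @ [s]))"
  shows "\<exists>c < n ^ (3 * Suc j). has_cycle (run (Suc j) c X) \<and>
    run (Suc j) c X \<subseteq> {..<n} \<and> f (run (Suc j) c X) \<le> f (set (A @ s # B)) + r / 2 ^ j"
  using assms
proof (induction j arbitrary: A s B X r)
  case 0
  note C = is_cycleD[OF 0(1)]
  have Xn: "X \<subseteq> {..<n}" using 0(2) C(3) by auto
  have sP: "spath s (s # B) (last (s # B))"
    using C by (auto simp: spath_def successively_append_iff)
  have all: "insert s X \<union> set (s # B) = set (A @ s # B)"
    using 0(2) by auto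
  have rpos: "0 \<le> r"
    unfolding 0(3) using f_mono[OF _ C(3), of "set (A @ [s])"] by auto
  have idle: "\<exists>c < n ^ (3 * Suc 0). run (Suc 0) c X = extend s u w X" if "u < n" "w < n" for u w
    using run_Suc_code[of s u w 0 0 X] that C(3) by auto
  \<comment> \<open>With the full cost of the cycle as threshold, the rest of the cycle is itself
    light: it is found entirely, or a collision exceeds the cost of the cycle by at most
    \<open>r\<close>.\<close>
  from extend_light[OF Xn sP, of "f (set (A @ s # B))"]
  consider "extend s (last (s # B)) (last (s # B)) X = set (A @ s # B)"
    | u w where "u < n" "w < n" "has_cycle (extend s u w X)" "extend s u w X \<subseteq> {..<n}"
      "f (extend s u w X) \<le> 2 * f (set (A @ s # B)) - f (set (A @ [s]))"
    unfolding all unfolding 0(2) by blast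
  then show ?case
  proof cases
    case 1
    have "last (s # B) < n" using C(3) last_in_set[of "s # B"] by auto
    from idle[OF this this] 1 show ?thesis
      using 0(1) C(3) rpos unfolding has_cycle_def by force
  next
    case (2 u w)
    then show ?thesis using idle[of u w] 0(3) by force
  qed
next
  case (Suc j)
  note C = is_cycleD[OF Suc.prems(1)]
  have Xn: "X \<subseteq> {..<n}" using Suc.prems(2) C(3) by auto
  have rpos: "0 \<le> r"
    unfolding Suc.prems(3) using f_mono[OF _ C(3), of "set (A @ [s])"] by auto
  have sn: "s < n" using C(3) by auto
  \<comment> \<open>Covers an early success: a cycle within the cost of the given one is already
    present, and the other rounds idle.\<close>
  have done_: ?case if *: "u < n" "w < n" "has_cycle (extend s u w X)" "s \<in> extend s u w X"
      "extend s u w X \<subseteq> {..<n}" "f (extend s u w X) \<le> f (set (A @ s # B))" for u w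
  proof -
    obtain c where c: "c < n ^ (3 * Suc j)" "run (Suc j) c (extend s u w X) = extend s u w X"
      using run_idle[OF *(5,4)] by blast
    obtain c' where "c' < n ^ (3 * Suc (Suc j))" "run (Suc (Suc j)) c' X = extend s u w X"
      using run_Suc_code[OF sn *(1,2) c(1)] c(2) by metis
    then show ?case
      using * rpos by (intro exI[of _ c']) (auto intro: order_trans)
  qed
  \<comment> \<open>Halfway between the secured cost and the full cost: a collision then costs at
    most the full cost, and any continuation above the threshold leaves less than half of
    \<open>r\<close> missing.\<close>
  define \<theta> where "\<theta> = f (set (A @ [s])) + r / 2"
  obtain B1 B2 where B: "B = B1 @ B2" "f (set (A @ s # B1)) \<le> \<theta>"
    and big: "\<And>x B3. B2 = x # B3 \<Longrightarrow> \<not> f (set (A @ s # B1 @ [x])) \<le> \<theta>"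
    using longest_prefix[of "\<lambda>B. f (set (A @ s # B)) \<le> \<theta>" B] rpos by (auto simp: \<theta>_def)
  define v where "v = last (s # B1)"
  have vn: "v < n" using C(3) B(1) last_in_set[of "s # B1"] by (auto simp: v_def)
  have sP: "spath s (s # B1) v"
    using C B(1) by (auto simp: spath_def successively_append_iff successively_Cons v_def)
  have all: "insert s X \<union> set (s # B1) = set (A @ s # B1)"
    using Suc.prems(2) by auto
  have "2 * \<theta> - f (set (A @ [s])) = f (set (A @ s # B))"
    by (simp add: \<theta>_def Suc.prems(3) field_simps)
  with extend_light[OF Xn sP, of \<theta>] B(2)
  consider "extend s v v X = set (A @ s # B1)"
    | u w where "u < n" "w < n" "has_cycle (extend s u w X)" "s \<in> extend s u w X"
      "extend s u w X \<subseteq> {..<n}" "f (extend s u w X) \<le> f (set (A @ s # B))"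
    unfolding all unfolding Suc.prems(2) by metis
  then show ?case
  proof cases
    case 1
    show ?thesis
    proof (cases B2)
      case Nil
      then have "extend s v v X = set (A @ s # B)" using 1 B by simp
      then show ?thesis
        using Suc.prems(1) C(3) has_cycle_def by (intro done_[OF vn vn]) auto
    next
      case (Cons x B3)
      \<comment> \<open>The vertex \<open>x\<close> that breaks the threshold becomes the start of
        the next round, and \<open>r'\<close> is measured with \<open>x\<close> included.\<close>
      let ?A = "A @ s # B1" and ?X = "extend s v v X"
      have eq: "?A @ x # B3 = A @ s # B" using B Cons by simp
      define r' where "r' = f (set (?A @ x # B3)) - f (set (?A @ [x]))"
      have "r' \<le> r / 2"
      proof -
        have "\<theta> < f (set (?A @ [x]))"
          using big[OF Cons] by simp
        moreover have "r' = f (set (A @ s # B)) - f (set (?A @ [x]))"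
          by (simp only: r'_def eq)
        ultimately show ?thesis
          using Suc.prems(3) unfolding \<theta>_def by argo
      qed
      have "is_cycle G (?A @ x # B3)" "insert x ?X = set (?A @ [x])"
        using Suc.prems(1) eq 1 by auto
      from Suc.IH[OF this r'_def] obtain c where c: "c < n ^ (3 * Suc j)"
        "has_cycle (run (Suc j) c ?X)" "run (Suc j) c ?X \<subseteq> {..<n}"
        "f (run (Suc j) c ?X) \<le> f (set (?A @ x # B3)) + r' / 2 ^ j"
        by blast
      obtain c' where "c' < n ^ (3 * Suc (Suc j))" "run (Suc (Suc j)) c' X = run (Suc j) c ?X"
        using run_Suc_code[OF sn vn vn c(1)] by blast
      moreover have "r' / 2 ^ j \<le> r / 2 ^ Suc j"
        using \<open>r' \<le> r / 2\<close> by (simp add: field_simps)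
      ultimately show ?thesis
        using c unfolding eq by (intro exI[of _ c']) auto
    qed
  next
    case (2 u w)
    then show ?thesis by (rule done_)
  qed
qed


section \<open>Extracting a cycle\<close>

definition peel1 :: "nat \<Rightarrow> nat set \<Rightarrow> nat set" where
  "peel1 v Y = (if card {w \<in> Y. adj v w} < 2 then Y - {v} else Y)"

text \<open>The sweep works in place, so later vertices see earlier deletions, as they do in array 8
  of the program.\<close>

definition peel :: "nat set \<Rightarrow> nat set" where
  "peel Y = fold peel1 [0..<n] Y"

text \<open>The 2-core of the subgraph induced by \<open>Y\<close>. A sweep that changes the set
  removes a vertex, so \<open>n\<close> sweeps reach the fixed point.\<close>

definition core :: "nat set \<Rightarrow> nat set" where
  "core Y = (peel ^^ n) Y"

text \<open>Minimum degree 2 in the induced subgraph. The empty set satisfies this vacuously, which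
  is why nonemptiness is always tested separately.\<close>

definition stable :: "nat set \<Rightarrow> bool" where
  "stable Y \<longleftrightarrow> (\<forall>v\<in>Y. 2 \<le> card {w \<in> Y. adj v w})"

lemma fold_peel1_subset: "fold peel1 vs Y \<subseteq> Y"
  by (induction vs arbitrary: Y) (auto simp: peel1_def split: if_splits)

lemma cycle_degree:
  assumes "is_cycle G C" "v \<in> set C" "set C \<subseteq> Y" "Y \<subseteq> {..<n}"
  shows "2 \<le> card {w \<in> Y. adj v w}"
proof -
  let ?m = "length C"
  have C: "3 \<le> ?m" "distinct C" "\<And>i. i < ?m \<Longrightarrow> adj (C ! i) (C ! (Suc i mod ?m))"
    using assms(1) by (auto simp: is_cycle_def)
  obtain i where i: "i < ?m" "v = C ! i" using assms(2) by (metis in_set_conv_nth)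
  define j where "j = (if i = 0 then ?m - 1 else i - 1)"
  define k where "k = Suc i mod ?m"
  have m: "0 < ?m" using i(1) by linarith
  have jk: "j < ?m" "k < ?m" "Suc j mod ?m = i"
    using C(1) i(1) mod_less_divisor[OF m, of "Suc i"] by (auto simp: j_def k_def)
  \<comment> \<open>The predecessor and the successor of \<open>v\<close> on the cycle differ
    because the length is at least 3.\<close>
  have "j \<noteq> k"
    using C(1) i(1) by (cases "Suc i = ?m") (auto simp: j_def k_def)
  then have "C ! j \<noteq> C ! k"
    using C(2) jk by (simp add: nth_eq_iff_index_eq)
  moreover have "{C ! j, C ! k} \<subseteq> {w \<in> Y. adj v w}"
    using C(3)[OF i(1)] C(3)[OF jk(1)] adj_sym jk i assms(3) by (auto simp: k_def)
  moreover have "finite {w \<in> Y. adj v w}"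
    using assms(4) finite_subset by fastforce
  ultimately show ?thesis
    using card_mono by (metis card_2_iff)
qed

lemma cycle_subset_core:
  assumes "is_cycle G C" "set C \<subseteq> Y" "Y \<subseteq> {..<n}"
  shows "set C \<subseteq> core Y"
proof -
  have 1: "set C \<subseteq> fold peel1 vs Y" if "set C \<subseteq> Y" "Y \<subseteq> {..<n}" for vs Y
    using that
  proof (induction vs arbitrary: Y)
    case (Cons v vs)
    have "set C \<subseteq> peel1 v Y"
      using Cons.prems cycle_degree[OF assms(1), of v Y] by (auto simp: peel1_def)
    moreover have "peel1 v Y \<subseteq> {..<n}"
      using Cons.prems by (auto simp: peel1_def)
    ultimately show ?case using Cons.IH by simp
  qed simp
  have "set C \<subseteq> (peel ^^ i) Y \<and> (peel ^^ i) Y \<subseteq> Y" for i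
  proof (induction i)
    case (Suc i)
    have sub: "peel ((peel ^^ i) Y) \<subseteq> (peel ^^ i) Y"
      unfolding peel_def by (rule fold_peel1_subset)
    have "(peel ^^ i) Y \<subseteq> {..<n}"
      using Suc assms(3) by blast
    then have "set C \<subseteq> peel ((peel ^^ i) Y)"
      using 1[of "(peel ^^ i) Y" "[0..<n]"] Suc by (simp add: peel_def[of "(peel ^^ i) Y"])
    then show ?case
      using sub Suc by auto
  qed (use assms in simp)
  then show ?thesis by (simp add: core_def)
qed

lemma core_props:
  assumes "Y \<subseteq> {..<n}"
  shows "core Y \<subseteq> Y" "stable (core Y)"
proof -
  \<comment> \<open>The steps of a sweep only delete, so a sweep without net effect contains no step
    with an effect.\<close>
  have fixpoint: "\<forall>v\<in>set vs. v \<in> Y \<longrightarrow> 2 \<le> card {w \<in> Y. adj v w}"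
    if "fold peel1 vs Y = Y" for vs Y
    using that
  proof (induction vs arbitrary: Y)
    case (Cons v vs)
    have "Y \<subseteq> peel1 v Y"
      using Cons.prems fold_peel1_subset[of vs "peel1 v Y"] by simp
    then have "peel1 v Y = Y" by (auto simp: peel1_def split: if_splits)
    then show ?case
      using Cons by (auto simp: peel1_def split: if_splits)
  qed simp
  have *: "(peel ^^ i) Y \<subseteq> Y \<and> (peel ((peel ^^ i) Y) = (peel ^^ i) Y \<or> card ((peel ^^ i) Y) + i \<le> n)" for i
  proof (induction i)
    case 0
    then show ?case using assms card_mono[of "{..<n}" Y] by auto
  next
    case (Suc i)
    let ?Z = "(peel ^^ i) Y"
    have sub: "peel ?Z \<subseteq> ?Z" by (simp add: peel_def fold_peel1_subset)
    have fin: "finite ?Z" using Suc assms by (meson finite_lessThan finite_subset)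
    show ?case
    proof (cases "peel ?Z = ?Z")
      case True
      then show ?thesis using Suc by simp
    next
      case False
      then have "card (peel ?Z) < card ?Z"
        using sub fin by (intro psubset_card_mono) auto
      then show ?thesis using Suc sub False by auto
    qed
  qed
  show sub: "core Y \<subseteq> Y" using * by (simp add: core_def)
  \<comment> \<open>At \<open>i = n\<close> the other alternative reads
    \<open>card (core Y) + n \<le> n\<close>.\<close>
  have "peel (core Y) = core Y \<or> core Y = {}"
    using *[of n] assms finite_subset[of "core Y" "{..<n}"] by (auto simp: core_def)
  then show "stable (core Y)"
    using fixpoint[of "[0..<n]" "core Y"] sub assms by (auto simp: stable_def peel_def)
qed

text \<open>
  A walk without backtracking; the first repeated vertex closes a cycle.
\<close>

definition walk_inv :: "nat set \<Rightarrow> nat list \<Rightarrow> nat \<Rightarrow> nat \<Rightarrow> bool" where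
  "walk_inv Z W prev cur \<longleftrightarrow> distinct W \<and> set W \<subseteq> Z \<and> cur \<in> Z \<and> successively adj (W @ [cur]) \<and>
     prev = last (cur # W) \<and> (\<forall>W' u. W = W' @ [u, prev] \<longrightarrow> cur \<noteq> u)"

lemma walk_inv_length:
  assumes "Z \<subseteq> {..<n}" "walk_inv Z W prev cur" "cur \<notin> set W"
  shows "length W < n"
proof -
  have "distinct (W @ [cur])" "set (W @ [cur]) \<subseteq> {..<n}"
    using assms by (auto simp: walk_inv_def)
  then have "length (W @ [cur]) \<le> n"
    by (metis card_lessThan card_mono distinct_card finite_lessThan)
  then show ?thesis by simp
qed

text \<open>At the start \<open>W = []\<close> and \<open>prev = cur\<close>; demanding
  \<open>next \<noteq> prev\<close> is then no restriction, because there are no loops.\<close>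

lemma walk_inv_step:
  assumes "walk_inv Z W prev cur" "cur \<notin> set W" "next \<in> Z" "adj cur next" "next \<noteq> prev"
  shows "walk_inv Z (W @ [cur]) cur next"
  using assms by (auto simp: walk_inv_def successively_append_iff)

lemma stable_next:
  assumes "stable Z" "cur \<in> Z"
  shows "\<exists>w\<in>Z. adj cur w \<and> w \<noteq> prev"
proof (rule ccontr)
  assume "\<not> ?thesis"
  then have "{w \<in> Z. adj cur w} \<subseteq> {prev}" by auto
  then have "card {w \<in> Z. adj cur w} \<le> 1"
    using card_mono[of "{prev}"] by fastforce
  then show False using assms by (auto simp: stable_def)
qed

text \<open>The walk from the first visit of \<open>cur\<close> onwards leads back to
  \<open>cur\<close>. Length 1 would need a loop, and length 2 a backtracking step.\<close>

lemma walk_inv_cycle: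
  assumes "walk_inv Z W prev cur" "j < length W" "W ! j = cur"
  shows "is_cycle G (drop j W)" "set (drop j W) \<subseteq> Z"
proof -
  have W: "distinct W" "set W \<subseteq> Z" "successively adj (W @ [cur])" "prev = last W"
    "\<And>W' u. W = W' @ [u, prev] \<Longrightarrow> cur \<noteq> u"
    using assms(1,2) by (auto simp: walk_inv_def split: if_splits)
  let ?C = "drop j W"
  have hd: "hd ?C = cur" using assms by (simp add: hd_drop_conv_nth)
  have split: "W @ [cur] = take j W @ (?C @ [cur])" by simp
  have chain: "successively adj (?C @ [cur])"
    using W(3) unfolding split successively_append_iff by blast
  have ne: "?C \<noteq> []" using assms by simp
  have last: "adj (last ?C) cur"
    using chain ne by (simp add: successively_append_iff)
  have "length ?C \<noteq> 1"
  proof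
    assume "length ?C = 1"
    then obtain x where "?C = [x]" by (metis One_nat_def length_0_conv length_Suc_conv)
    then show False using hd last adj_irrefl by auto
  qed
  moreover have "length ?C \<noteq> 2"
  proof
    assume "length ?C = 2"
    then obtain x y where xy: "?C = [x, y]" by (metis length_0_conv length_Suc_conv numeral_2_eq_2)
    then have "W = take j W @ [x, y]" by (metis append_take_drop_id)
    moreover have "y = prev"
      using W(4) xy assms(2) by (metis last.simps last_drop length_greater_0_conv list.distinct(1) not_less)
    ultimately show False using W(5)[of "take j W" x] hd xy by simp
  qed
  moreover have "length ?C \<noteq> 0" using ne by simp
  ultimately have "3 \<le> length ?C" by linarith
  moreover have "distinct ?C" using W(1) by simp
  moreover have "successively adj ?C"
    using chain by (simp add: successively_append_iff)
  ultimately show "is_cycle G ?C"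
    using last hd by (intro is_cycleI) auto
  show "set ?C \<subseteq> Z"
    using W(2) set_drop_subset by fastforce
qed

end

section \<open>Verifying programs\<close>

lemma imem_iset [simp]: "imem (iset a i x s) = (imem s)(a := (imem s a)(i := x))"
  and rmem_iset [simp]: "rmem (iset a i x s) = rmem s"
  and imem_rset [simp]: "imem (rset a i y s) = imem s"
  and rmem_rset [simp]: "rmem (rset a i y s) = (rmem s)(a := (rmem s a)(i := y))"
  by (simp_all add: iset_def rset_def)

primrec iwrites :: "com \<Rightarrow> nat set" where
  "iwrites Skip = {}"
| "iwrites (ISet a i e) = {a}"
| "iwrites (RSet a i e) = {}"
| "iwrites (Seq c1 c2) = iwrites c1 \<union> iwrites c2"
| "iwrites (If b c1 c2) = iwrites c1 \<union> iwrites c2"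
| "iwrites (While b c) = iwrites c"

primrec rwrites :: "com \<Rightarrow> nat set" where
  "rwrites Skip = {}"
| "rwrites (ISet a i e) = {}"
| "rwrites (RSet a i e) = {a}"
| "rwrites (Seq c1 c2) = rwrites c1 \<union> rwrites c2"
| "rwrites (If b c1 c2) = rwrites c1 \<union> rwrites c2"
| "rwrites (While b c) = rwrites c"

text \<open>A frame condition read off the program text, so that the specifications below mention
  only what a program changes.\<close>

definition agree :: "com \<Rightarrow> state \<Rightarrow> state \<Rightarrow> bool" where
  "agree c s s' \<longleftrightarrow> (\<forall>a. a \<notin> iwrites c \<longrightarrow> imem s' a = imem s a) \<and>
     (\<forall>a. a \<notin> rwrites c \<longrightarrow> rmem s' a = rmem s a)"

lemma exec_agree: "exec n f c s t s' \<Longrightarrow> agree c s s'"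
  by (induction rule: exec.induct) (auto simp: agree_def)

lemma agree_refl: "agree c s s"
  by (simp add: agree_def)

lemma agree_trans: "agree c s s' \<Longrightarrow> agree c s' s'' \<Longrightarrow> agree c s s''"
  by (simp add: agree_def)

text \<open>
  If every loop makes at most \<open>n ^ a\<close> iterations and \<open>n \<ge> 2\<close>, then \<open>c\<close> takes time at most
  \<open>n ^ cexp a c\<close>: sums of powers of \<open>n\<close> are bounded by products.
\<close>

primrec cexp :: "nat \<Rightarrow> com \<Rightarrow> nat" where
  "cexp a Skip = 1"
| "cexp a (ISet x i e) = icost i + icost e + 1"
| "cexp a (RSet x i e) = icost i + rcost e + 1"
| "cexp a (Seq c1 c2) = cexp a c1 + cexp a c2"
| "cexp a (If b c1 c2) = bcost b + 1 + cexp a c1 + cexp a c2"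
| "cexp a (While b c) = a + 1 + (bcost b + 1) + cexp a c"

lemma cexp_pos: "0 < cexp a c"
  by (induction c) auto

text \<open>The source of the logarithm in the final exponent: \<open>a\<close> will be proportional
  to the number of rounds, and \<open>cexp 1 c\<close> depends on the program alone.\<close>

lemma cexp_linear:
  assumes "0 < a"
  shows "cexp a c \<le> cexp 1 c * a"
proof -
  have le: "k \<le> k * a" for k using assms by (cases a) auto
  show ?thesis
  proof (induction c)
    case (Seq c1 c2)
    then show ?case by (simp add: algebra_simps)
  next
    case (If b c1 c2)
    have "bcost b + 1 + cexp a c1 + cexp a c2 \<le> (bcost b + 1) * a + cexp 1 c1 * a + cexp 1 c2 * a"
      using If le by (intro add_mono)
    then show ?case by (simp add: algebra_simps)
  next
    case (While b c)
    have "a + (1 + (bcost b + 1)) + cexp a c \<le> a + (1 + (bcost b + 1)) * a + cexp 1 c * a"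
      using While le by (intro add_mono order_refl)
    then show ?case by (simp add: algebra_simps)
  qed (unfold cexp.simps, (rule le)+)
qed

definition FOR :: "nat \<Rightarrow> iexp \<Rightarrow> com \<Rightarrow> com" where
  "FOR i e c = Seq (ISet i (INum 0) (INum 0))
     (While (ILess (IGet i (INum 0)) e) (Seq c (ISet i (INum 0) (IAdd (IGet i (INum 0)) (INum 1)))))"

lemma writes_FOR [simp]: "iwrites (FOR i e c) = insert i (iwrites c)" "rwrites (FOR i e c) = rwrites c"
  by (auto simp: FOR_def)

locale bounded_machine = submodular_graph +
  fixes a :: nat
  assumes n3: "3 \<le> n" and a1: "1 \<le> a"
begin

text \<open>A total-correctness judgement with the time bound built in, so that each rule settles
  termination, time and result together.\<close>

definition runs :: "com \<Rightarrow> state \<Rightarrow> (state \<Rightarrow> bool) \<Rightarrow> bool" where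
  "runs c s Q \<longleftrightarrow> (\<exists>t s'. exec n f c s t s' \<and> t \<le> n ^ cexp a c \<and> Q s')"

lemma le_power_n: "k \<le> n ^ k"
proof -
  have "k < 2 ^ k" by (rule less_exp)
  also have "(2::nat) ^ k \<le> n ^ k" using n3 by (intro power_mono) auto
  finally show ?thesis by simp
qed

text \<open>Both powers are at least 2, and the sum of two such numbers is at most their
  product.\<close>

lemma power_n_add: "0 < k \<Longrightarrow> 0 < l \<Longrightarrow> n ^ k + n ^ l \<le> n ^ (k + l)"
proof -
  assume "0 < k" "0 < l"
  have 2: "2 \<le> n ^ i" if "0 < i" for i
  proof -
    have "n ^ 1 \<le> n ^ i" using n3 that by (intro power_increasing) auto
    then show ?thesis using n3 by simp
  qed
  obtain x y where "n ^ k = x + 2" "n ^ l = y + 2"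
    using 2[OF \<open>0 < k\<close>] 2[OF \<open>0 < l\<close>] by (metis add.commute le_Suc_ex)
  then show ?thesis by (simp add: power_add algebra_simps)
qed

lemma runs_conseq:
  "runs c s Q \<Longrightarrow> (\<And>s'. agree c s s' \<Longrightarrow> Q s' \<Longrightarrow> Q' s') \<Longrightarrow> runs c s Q'"
  unfolding runs_def using exec_agree by blast

lemma runs_Skip: "Q s \<Longrightarrow> runs Skip s Q"
  unfolding runs_def using exec.Skip[of n f s] n3 by (intro exI[of _ 1] exI[of _ s]) simp

lemma runs_ISet: "Q (iset x (ival i s) (ival e s) s) \<Longrightarrow> runs (ISet x i e) s Q"
  unfolding runs_def using exec.ISet[of n f x i e s] le_power_n[of "icost i + icost e + 1"] by force

lemma runs_RSet: "Q (rset x (ival i s) (rval n f e s) s) \<Longrightarrow> runs (RSet x i e) s Q"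
  unfolding runs_def using exec.RSet[of n f x i e s] le_power_n[of "icost i + rcost e + 1"] by force

lemma runs_Seq: "runs c1 s (\<lambda>s'. runs c2 s' Q) \<Longrightarrow> runs (Seq c1 c2) s Q"
  unfolding runs_def
proof (elim exE conjE)
  fix t1 s1 t2 s2
  assume *: "exec n f c1 s t1 s1" "t1 \<le> n ^ cexp a c1" "exec n f c2 s1 t2 s2" "t2 \<le> n ^ cexp a c2" "Q s2"
  have "t1 + t2 \<le> n ^ cexp a (Seq c1 c2)"
    using *(2,4) power_n_add[OF cexp_pos cexp_pos, of a c1 a c2] by simp
  then show "\<exists>t s'. exec n f (Seq c1 c2) s t s' \<and> t \<le> n ^ cexp a (Seq c1 c2) \<and> Q s'"
    using * exec.Seq by blast
qed

lemma runs_If: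
  assumes "bval n f b s \<Longrightarrow> runs c1 s Q" "\<not> bval n f b s \<Longrightarrow> runs c2 s Q"
  shows "runs (If b c1 c2) s Q"
proof -
  have *: "bcost b + t + 1 \<le> n ^ (bcost b + 1 + k + l)" if "t \<le> n ^ k" "0 < k" for t k l
  proof -
    have "bcost b + 1 + t \<le> n ^ (bcost b + 1) + n ^ k"
      using le_power_n[of "bcost b + 1"] that by simp
    also have "\<dots> \<le> n ^ (bcost b + 1 + k)"
      using that by (intro power_n_add) auto
    also have "\<dots> \<le> n ^ (bcost b + 1 + k + l)"
      using n3 by (intro power_increasing) auto
    finally show ?thesis by simp
  qed
  show ?thesis
  proof (cases "bval n f b s")
    case True
    then obtain t s' where t: "exec n f c1 s t s'" "t \<le> n ^ cexp a c1" "Q s'"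
      using assms(1) unfolding runs_def by blast
    have "bcost b + t + 1 \<le> n ^ cexp a (If b c1 c2)"
      using *[OF t(2) cexp_pos, of "cexp a c2"] by simp
    then show ?thesis
      unfolding runs_def using exec.IfTrue[OF True t(1)] t(3) by blast
  next
    case False
    then obtain t s' where t: "exec n f c2 s t s'" "t \<le> n ^ cexp a c2" "Q s'"
      using assms(2) unfolding runs_def by blast
    have "bcost b + t + 1 \<le> n ^ cexp a (If b c1 c2)"
      using *[OF t(2) cexp_pos, of "cexp a c1"] by (simp add: ac_simps)
    then show ?thesis
      unfolding runs_def using exec.IfFalse[OF False t(1)] t(3) by blast
  qed
qed

text \<open>The invariant is indexed by the number of completed iterations; that the guard forces
  \<open>k < N\<close> yields both termination and the iteration bound.\<close>

lemma runs_While: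
  assumes I0: "I 0 s" and N: "N \<le> n ^ a"
    and body: "\<And>k s'. agree c s s' \<Longrightarrow> I k s' \<Longrightarrow> bval n f b s' \<Longrightarrow> k < N \<and> runs c s' (I (Suc k))"
    and post: "\<And>k s'. agree c s s' \<Longrightarrow> I k s' \<Longrightarrow> \<not> bval n f b s' \<Longrightarrow> Q s'"
  shows "runs (While b c) s Q"
proof -
  let ?T = "n ^ cexp a c + bcost b + 1"
  have *: "\<exists>t s''. exec n f (While b c) s' t s'' \<and> t \<le> d * ?T + bcost b + 1 \<and> Q s''"
    if "I k s'" "agree c s s'" "d = N - k" for k d s'
    using that
  proof (induction d arbitrary: k s')
    case 0
    then have "\<not> bval n f b s'" using body by fastforce
    then show ?case using exec.WhileFalse post 0 by (metis le_refl mult_0 add_0)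
  next
    case (Suc d)
    show ?case
    proof (cases "bval n f b s'")
      case False
      then show ?thesis using exec.WhileFalse[OF False] post[OF Suc.prems(2,1) False] by force
    next
      case True
      from body[OF Suc.prems(2,1) True] obtain t1 s1 where
        1: "exec n f c s' t1 s1" "t1 \<le> n ^ cexp a c" "I (Suc k) s1"
        unfolding runs_def by blast
      have ag: "agree c s s1"
        using agree_trans[OF Suc.prems(2) exec_agree[OF 1(1)]] .
      have "d = N - Suc k" using Suc.prems(3) by simp
      from Suc.IH[OF 1(3) ag this] obtain t2 s2 where
        2: "exec n f (While b c) s1 t2 s2" "t2 \<le> d * ?T + bcost b + 1" "Q s2" by blast
      have "exec n f (While b c) s' (bcost b + t1 + t2 + 1) s2"
        by (rule exec.WhileTrue[OF True 1(1) 2(1)])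
      moreover have "bcost b + t1 + t2 + 1 \<le> Suc d * ?T + bcost b + 1"
        using 1(2) 2(2) by simp
      ultimately show ?thesis using 2(3) by blast
    qed
  qed
  obtain t s'' where t: "exec n f (While b c) s t s''" "t \<le> N * ?T + bcost b + 1" "Q s''"
    using *[OF I0 agree_refl refl] by auto
  \<comment> \<open>The final, failing test of the guard is charged as one more iteration.\<close>
  have "N * ?T + bcost b + 1 \<le> (N + 1) * ?T" by simp
  also have "N + 1 \<le> n ^ (a + 1)"
  proof -
    have "N + 1 \<le> n ^ a + n ^ a" using N n3 by (intro add_mono) auto
    also have "\<dots> = 2 * n ^ a" by simp
    also have "\<dots> \<le> n * n ^ a" using n3 by (intro mult_le_mono1) simp
    finally show ?thesis by simp
  qed
  then have "(N + 1) * ?T \<le> n ^ (a + 1) * ?T" by (rule mult_le_mono1)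
  also have "?T \<le> n ^ (bcost b + 1) + n ^ cexp a c"
    using le_power_n[of "bcost b + 1"] by simp
  then have "n ^ (a + 1) * ?T \<le> n ^ (a + 1) * n ^ (bcost b + 1 + cexp a c)"
    using power_n_add[OF _ cexp_pos, of "bcost b + 1" a c] by (intro mult_le_mono2) simp
  also have "\<dots> = n ^ cexp a (While b c)" by (simp add: power_add algebra_simps)
  finally show ?thesis
    unfolding runs_def using t order_trans by blast
qed

text \<open>The bound expression is evaluated anew at each test, so it must have the value
  \<open>N\<close> in every state that the loop can reach according to its write sets.\<close>

lemma runs_FOR:
  assumes N: "N \<le> n ^ a" and i: "i \<notin> iwrites c"
    and bound: "\<And>s'. agree (FOR i e c) s s' \<Longrightarrow> ival e s' = N"
    and I0: "I 0 (iset i 0 0 s)"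
    and body: "\<And>k s'. k < N \<Longrightarrow> agree (FOR i e c) s s' \<Longrightarrow> imem s' i 0 = k \<Longrightarrow> I k s' \<Longrightarrow>
      runs c s' (\<lambda>s''. I (Suc k) (iset i 0 (Suc k) s''))"
    and post: "\<And>s'. agree (FOR i e c) s s' \<Longrightarrow> I N s' \<Longrightarrow> Q s'"
  shows "runs (FOR i e c) s Q"
proof -
  let ?J = "\<lambda>k s'. k \<le> N \<and> imem s' i 0 = k \<and> I k s'"
  let ?s = "iset i (ival (INum 0) s) (ival (INum 0) s) s"
  let ?inc = "ISet i (INum 0) (IAdd (IGet i (INum 0)) (INum 1))"
  show ?thesis
    unfolding FOR_def
  proof (rule runs_Seq, rule runs_ISet, rule runs_While[where I = ?J and N = N])
    show "N \<le> n ^ a" by (rule N)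
    show "?J 0 ?s" using I0 by simp
    fix k s' assume ag: "agree (Seq c ?inc) ?s s'" and J: "?J k s'"
    have ag': "agree (FOR i e c) s s'"
      using ag by (auto simp: agree_def)
    show "k < N \<and> runs (Seq c ?inc) s' (?J (Suc k))"
      if b: "bval n f (ILess (IGet i (INum 0)) e) s'"
    proof
      show kN: "k < N" using b J bound[OF ag'] by simp
      show "runs (Seq c ?inc) s' (?J (Suc k))"
      proof (rule runs_Seq, rule runs_conseq)
        show "runs c s' (\<lambda>s''. I (Suc k) (iset i 0 (Suc k) s''))"
          using body[OF kN ag'] J by simp
        fix s'' assume "agree c s' s''" "I (Suc k) (iset i 0 (Suc k) s'')"
        then show "runs ?inc s'' (?J (Suc k))"
          using i J kN by (intro runs_ISet) (auto simp: agree_def)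
      qed
    qed
    show "Q s'" if b: "\<not> bval n f (ILess (IGet i (INum 0)) e) s'"
      using b J bound[OF ag'] post[OF ag'] by (metis bval.simps(1) ival.simps(1,2) le_neq_implies_less)
  qed
qed

lemma n_le_pow: "n \<le> n ^ a"
  using power_increasing[of 1 a n] n3 a1 by simp

end

section \<open>The program\<close>

abbreviation V :: "nat \<Rightarrow> iexp" where
  "V x \<equiv> IGet x (INum 0)"

abbreviation set_var :: "nat \<Rightarrow> iexp \<Rightarrow> com" where
  "set_var x e \<equiv> ISet x (INum 0) e"

text \<open>
  Array 0 holds \<open>n\<close>, array 1 the adjacency matrix, array 3 the row offsets \<open>u * n\<close> (there is no
  multiplication of natural numbers), array 4 the current set \<open>X\<close>, array 5 the tree paths by rows,
  array 6 the vertices of the tree, array 7 the argument of a query, array 8 the core of \<open>X\<close> and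
  array 9 the best core found so far; arrays 11 and 12 belong to the final walk. The arrays from 20
  on are scalar variables. The real array 3 holds the score of the best pair in
  \<open>select_com\<close>, the real array 4 that of the best core.
\<close>

abbreviation entry :: "nat \<Rightarrow> iexp \<Rightarrow> iexp \<Rightarrow> iexp" where
  "entry x e1 e2 \<equiv> IGet x (IAdd (IGet 3 e1) e2)"

abbreviation pos :: "iexp \<Rightarrow> bexp" where
  "pos e \<equiv> ILess (INum 0) e"

definition score_exp :: "nat \<Rightarrow> rexp" where
  "score_exp x = RDiv (RNat (INum 1)) (RAdd (RNat (INum 1)) (Query x))"

text \<open>Addition serves as union: a sum of naturals is positive iff a summand is. Membership
  therefore means a nonzero cell, not a cell equal to 1.\<close>

definition query_com :: com where
  "query_com = Seq
     (FOR 22 (V 0) (ISet 7 (V 22) (IAdd (IGet 4 (V 22)) (entry 5 (V 20) (V 22)))))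
     (ISet 7 (V 21) (INum 1))"

definition test_com :: com where
  "test_com = If (BAnd (BAnd (pos (IGet 6 (V 20))) (pos (entry 1 (V 20) (V 21)))) (BNot (pos (IGet 6 (V 21)))))
     (Seq query_com
       (If (RLess (RGet 3 (INum 0)) (score_exp 7))
         (Seq (set_var 23 (V 20)) (Seq (set_var 24 (V 21)) (RSet 3 (INum 0) (score_exp 7))))
         Skip))
     Skip"

definition select_com :: com where
  "select_com = Seq (RSet 3 (INum 0) (RNat (INum 0))) (Seq (set_var 23 (INum 0)) (Seq (set_var 24 (INum 0))
     (FOR 20 (V 0) (FOR 21 (V 0) test_com))))"

definition grow_com :: com where
  "grow_com = Seq select_com (If (RLess (RNat (INum 0)) (RGet 3 (INum 0)))
     (Seq (FOR 22 (V 0) (ISet 5 (IAdd (IGet 3 (V 24)) (V 22)) (entry 5 (V 23) (V 22))))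
       (Seq (ISet 5 (IAdd (IGet 3 (V 24)) (V 24)) (INum 1)) (ISet 6 (V 24) (INum 1))))
     Skip)"

definition tree_com :: com where
  "tree_com = Seq
     (FOR 20 (V 0) (Seq (ISet 6 (V 20) (INum 0))
       (FOR 21 (V 0) (ISet 5 (IAdd (IGet 3 (V 20)) (V 21)) (INum 0)))))
     (Seq (ISet 6 (V 25) (INum 1)) (Seq (ISet 5 (IAdd (IGet 3 (V 25)) (V 25)) (INum 1))
       (FOR 26 (V 0) grow_com)))"

definition add_path_com :: "nat \<Rightarrow> com" where
  "add_path_com x = FOR 22 (V 0) (ISet 4 (V 22) (IAdd (IGet 4 (V 22)) (entry 5 (V x) (V 22))))"

text \<open>Division with remainder by repeated subtraction. The remainder stays in array 28 until
  it is moved to \<open>x\<close>, and the quotient then replaces the code.\<close>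

definition digit_com :: "nat \<Rightarrow> com" where
  "digit_com x = Seq (set_var 29 (INum 0)) (Seq
     (While (BNot (ILess (V 28) (V 0)))
       (Seq (set_var 28 (ISub (V 28) (V 0))) (set_var 29 (IAdd (V 29) (INum 1)))))
     (Seq (set_var x (V 28)) (set_var 28 (V 29))))"

definition extend_com :: com where
  "extend_com = Seq (digit_com 25) (Seq (digit_com 30) (Seq (digit_com 31)
     (Seq (ISet 4 (V 25) (INum 1)) (Seq tree_com (Seq (add_path_com 30) (add_path_com 31))))))"

definition degree_com :: com where
  "degree_com = Seq (set_var 23 (INum 0)) (FOR 22 (V 0)
     (If (BAnd (pos (IGet 8 (V 22))) (pos (entry 1 (V 21) (V 22))))
       (set_var 23 (IAdd (V 23) (INum 1))) Skip))"

definition core_com :: com where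
  "core_com = Seq (FOR 20 (V 0) (ISet 8 (V 20) (IGet 4 (V 20))))
     (FOR 20 (V 0) (FOR 21 (V 0)
       (Seq degree_com (If (ILess (V 23) (INum 2)) (ISet 8 (V 21) (INum 0)) Skip))))"

definition nonempty_com :: com where
  "nonempty_com = Seq (set_var 23 (INum 0))
     (FOR 20 (V 0) (If (pos (IGet 8 (V 20))) (set_var 23 (INum 1)) Skip))"

text \<open>The flag in array 23 keeps out the empty core, which by monotonicity would have the
  highest score.\<close>

definition update_com :: com where
  "update_com = If (BAnd (pos (V 23)) (RLess (RGet 4 (INum 0)) (score_exp 8)))
     (Seq (RSet 4 (INum 0) (score_exp 8)) (FOR 20 (V 0) (ISet 9 (V 20) (IGet 8 (V 20)))))
     Skip"

definition candidate_com :: com where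
  "candidate_com = Seq (FOR 20 (V 0) (ISet 4 (V 20) (INum 0))) (Seq (set_var 28 (V 32))
     (Seq (FOR 33 (V 34) extend_com) (Seq core_com (Seq nonempty_com update_com))))"

text \<open>The number of codes is held as a real because it arises by multiplication, which the
  machine offers for reals only.\<close>

definition search_com :: com where
  "search_com = Seq (set_var 32 (INum 0)) (While (RLess (RNat (V 32)) (RGet 2 (INum 0)))
     (Seq candidate_com (set_var 32 (IAdd (V 32) (INum 1)))))"

text \<open>Doubling a copy of \<open>\<epsilon>\<close> until it reaches 1 counts the rounds
  without computing a logarithm.\<close>

definition init_com :: com where
  "init_com = Seq
     (FOR 20 (V 0) (ISet 3 (IAdd (V 20) (INum 1)) (IAdd (IGet 3 (V 20)) (V 0))))
     (Seq (RSet 1 (INum 0) (RGet 0 (INum 0)))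
     (Seq (RSet 2 (INum 0) (RMul (RNat (V 0)) (RMul (RNat (V 0)) (RNat (V 0)))))
     (Seq (set_var 34 (INum 1))
       (While (RLess (RGet 1 (INum 0)) (RNat (INum 1)))
         (Seq (RSet 1 (INum 0) (RAdd (RGet 1 (INum 0)) (RGet 1 (INum 0))))
         (Seq (RSet 2 (INum 0) (RMul (RGet 2 (INum 0)) (RMul (RNat (V 0)) (RMul (RNat (V 0)) (RNat (V 0))))))
           (set_var 34 (IAdd (V 34) (INum 1)))))))))"

text \<open>The last test expresses that the scanned vertex differs from the previous one; the
  language has only strict comparisons.\<close>

definition next_com :: com where
  "next_com = FOR 22 (V 0)
     (If (BAnd (BAnd (pos (IGet 9 (V 22))) (pos (entry 1 (V 23) (V 22))))
         (BNot (BAnd (BNot (ILess (V 22) (V 24))) (BNot (ILess (V 24) (V 22))))))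
       (set_var 26 (V 22)) Skip)"

text \<open>Array 11 lists the walk, and array 12 stores positions plus one, so that 0 marks an
  unvisited vertex. At the first repetition it tells where the cycle begins.\<close>

definition walk_com :: com where
  "walk_com =
     Seq (FOR 20 (V 0) (If (pos (IGet 9 (V 20))) (set_var 23 (V 20)) Skip))
     (Seq (set_var 24 (V 23)) (Seq (set_var 25 (INum 0))
     (Seq (While (BNot (pos (IGet 12 (V 23))))
       (Seq (ISet 11 (V 25) (V 23)) (Seq (set_var 25 (IAdd (V 25) (INum 1)))
         (Seq (ISet 12 (V 23) (V 25)) (Seq next_com (Seq (set_var 24 (V 23)) (set_var 23 (V 26))))))))
     (Seq (set_var 27 (ISub (IGet 12 (V 23)) (INum 1))) (Seq (set_var 2 (ISub (V 25) (V 27)))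
     (FOR 20 (ISub (V 25) (V 27)) (ISet 2 (IAdd (V 20) (INum 1)) (IGet 11 (IAdd (V 27) (V 20))))))))))"

definition cycle_com :: com where
  "cycle_com = Seq init_com (Seq search_com walk_com)"

lemma writes_query_com [simp]:
  "iwrites query_com = {7, 22}"
  "rwrites query_com = {}"
  by (auto simp: query_com_def)

lemma writes_test_com [simp]:
  "iwrites test_com = {7, 22, 23, 24}"
  "rwrites test_com = {3}"
  by (auto simp: test_com_def)

lemma writes_select_com [simp]:
  "iwrites select_com = {7, 20, 21, 22, 23, 24}"
  "rwrites select_com = {3}"
  by (auto simp: select_com_def)

lemma writes_grow_com [simp]:
  "iwrites grow_com = {5, 6, 7, 20, 21, 22, 23, 24}"
  "rwrites grow_com = {3}"
  by (auto simp: grow_com_def)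

lemma writes_tree_com [simp]:
  "iwrites tree_com = {5, 6, 7, 20, 21, 22, 23, 24, 26}"
  "rwrites tree_com = {3}"
  by (auto simp: tree_com_def)

lemma writes_add_path_com [simp]:
  "iwrites (add_path_com x) = {4, 22}"
  "rwrites (add_path_com x) = {}"
  by (auto simp: add_path_com_def)

lemma writes_digit_com [simp]:
  "iwrites (digit_com x) = {28, 29, x}"
  "rwrites (digit_com x) = {}"
  by (auto simp: digit_com_def)

lemma writes_extend_com [simp]:
  "iwrites extend_com = {4, 5, 6, 7, 20, 21, 22, 23, 24, 25, 26, 28, 29, 30, 31}"
  "rwrites extend_com = {3}"
  by (auto simp: extend_com_def)

lemma writes_degree_com [simp]:
  "iwrites degree_com = {22, 23}"
  "rwrites degree_com = {}"
  by (auto simp: degree_com_def)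

lemma writes_core_com [simp]:
  "iwrites core_com = {8, 20, 21, 22, 23}"
  "rwrites core_com = {}"
  by (auto simp: core_com_def)

lemma writes_nonempty_com [simp]:
  "iwrites nonempty_com = {20, 23}"
  "rwrites nonempty_com = {}"
  by (auto simp: nonempty_com_def)

lemma writes_update_com [simp]:
  "iwrites update_com = {9, 20}"
  "rwrites update_com = {4}"
  by (auto simp: update_com_def)

lemma writes_candidate_com [simp]:
  "iwrites candidate_com = {4, 5, 6, 7, 8, 9, 20, 21, 22, 23, 24, 25, 26, 28, 29, 30, 31, 33}"
  "rwrites candidate_com = {4, 3}"
  by (auto simp: candidate_com_def)

lemma writes_search_com [simp]:
  "iwrites search_com = insert 32 (iwrites candidate_com)"
  "rwrites search_com = rwrites candidate_com"
  by (auto simp add: search_com_def simp del: writes_candidate_com)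

lemma writes_init_com [simp]:
  "iwrites init_com = {20, 3, 34}"
  "rwrites init_com = {1, 2}"
  by (auto simp: init_com_def)

lemma writes_next_com [simp]:
  "iwrites next_com = {22, 26}"
  "rwrites next_com = {}"
  by (auto simp: next_com_def)

section \<open>Correctness of the program\<close>

context bounded_machine
begin

section \<open>Memory contents as vertex sets\<close>

definition env :: "state \<Rightarrow> bool" where
  "env s \<longleftrightarrow> imem s 0 0 = n \<and> (\<forall>u<n. imem s 3 u = u * n) \<and>
     (\<forall>u<n. \<forall>v<n. 0 < imem s 1 (u * n + v) \<longleftrightarrow> adj u v)"

definition aset :: "state \<Rightarrow> nat \<Rightarrow> nat set" where
  "aset s x = {v. v < n \<and> 0 < imem s x v}"

text \<open>The conjunct \<open>v < n\<close> empties the rows beyond the table, so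
  \<open>row s\<close> can equal, as a function, the path table with which \<open>tree\<close>
  starts.\<close>

definition row :: "state \<Rightarrow> nat \<Rightarrow> nat set" where
  "row s v = {x. v < n \<and> x < n \<and> 0 < imem s 5 (v * n + x)}"

lemma env_iset [simp]: "x \<notin> {0, 1, 3} \<Longrightarrow> env (iset x i y s) = env s"
  by (auto simp: env_def)

lemma env_rset [simp]: "env (rset x i y s) = env s"
  by (simp add: env_def)

lemma env_agree: "env s \<Longrightarrow> agree c s s' \<Longrightarrow> 0 \<notin> iwrites c \<and> 1 \<notin> iwrites c \<and> 3 \<notin> iwrites c \<Longrightarrow> env s'"
  by (auto simp: env_def agree_def)

lemma env_0: "env s \<Longrightarrow> imem s 0 0 = n"
  and env_1: "env s \<Longrightarrow> u < n \<Longrightarrow> v < n \<Longrightarrow> (0 < imem s (Suc 0) (u * n + v)) = adj u v"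
  and env_3: "env s \<Longrightarrow> u < n \<Longrightarrow> imem s 3 u = u * n"
  by (auto simp: env_def)

lemma env_1': "env s \<Longrightarrow> u < n \<Longrightarrow> v < n \<Longrightarrow> (imem s (Suc 0) (u * n + v) = 0) = (\<not> adj u v)"
  using env_1 by (metis neq0_conv)

lemma aset_subset: "aset s x \<subseteq> {..<n}"
  by (auto simp: aset_def)

lemma row_subset: "row s v \<subseteq> {..<n}"
  by (auto simp: row_def)

lemma aset_iset [simp]: "x \<noteq> y \<Longrightarrow> aset (iset x i k s) y = aset s y"
  and aset_rset [simp]: "aset (rset x i r s) y = aset s y"
  and row_iset [simp]: "x \<noteq> 5 \<Longrightarrow> row (iset x i k s) = row s"
  and row_rset [simp]: "row (rset x i r s) = row s"
  by (simp_all add: aset_def row_def fun_eq_iff)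

lemma aset_agree: "agree c s s' \<Longrightarrow> x \<notin> iwrites c \<Longrightarrow> aset s' x = aset s x"
  by (simp add: aset_def agree_def)

lemma index_eq:
  assumes "x < n" "y < n"
  shows "u * n + x = v * n + y \<longleftrightarrow> u = v \<and> x = y"
proof
  assume "u * n + x = v * n + y"
  then have "(u * n + x) div n = (v * n + y) div n" "(u * n + x) mod n = (v * n + y) mod n"
    by simp_all
  then show "u = v \<and> x = y" using assms by simp
qed simp

lemma score_exp_val [simp]: "rval n f (score_exp x) s = score (aset s x)"
  by (simp add: score_exp_def score_def aset_def)

section \<open>The tree search in memory\<close>

lemma query_com_runs:
  assumes "env s" "imem s 20 0 = u" "u < n" "imem s 21 0 = v" "v < n"
  shows "runs query_com s (\<lambda>s'. aset s' 7 = aset s 4 \<union> row s u \<union> {v})"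
  unfolding query_com_def
proof (rule runs_Seq, rule runs_FOR[where N = n and
    I = "\<lambda>k s'. \<forall>x<k. imem s' 7 x = imem s 4 x + imem s 5 (u * n + x)"])
  fix s' assume "agree (FOR 22 (V 0) (ISet 7 (V 22) (IAdd (IGet 4 (V 22)) (entry 5 (V 20) (V 22))))) s s'"
    "\<forall>x<n. imem s' 7 x = imem s 4 x + imem s 5 (u * n + x)"
  then show "runs (ISet 7 (V 21) (INum 1)) s' (\<lambda>s'. aset s' 7 = aset s 4 \<union> row s u \<union> {v})"
    using assms by (intro runs_ISet) (auto simp: agree_def aset_def row_def)
qed (use assms env_0 env_3 n_le_pow in \<open>auto simp: agree_def less_Suc_eq intro!: runs_ISet\<close>)

lemma test_com_runs:
  assumes "env s" "imem s 20 0 = u" "u < n" "imem s 21 0 = v" "v < n"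
  shows "runs test_com s (\<lambda>s'. (imem s' 23 0, imem s' 24 0, rmem s' 3 0) =
    select1 (aset s 4) (aset s 6) (row s) u v (imem s 23 0, imem s 24 0, rmem s 3 0))"
  unfolding test_com_def
proof (rule runs_If, rule runs_Seq, rule runs_conseq[OF query_com_runs[OF assms]], goal_cases)
  case (1 s')
  then show ?case
    using assms env_1[OF assms(1)] env_1'[OF assms(1)] env_3[OF assms(1)]
    by (auto simp: agree_def aset_def select1_def valid_def Let_def
        intro!: runs_If runs_Seq runs_ISet runs_RSet runs_Skip simp del: Un_insert_right)
next
  case 2
  then show ?case
    using assms env_1[OF assms(1)] env_1'[OF assms(1)] env_3[OF assms(1)]
    by (auto simp: aset_def select1_def valid_def Let_def intro!: runs_Skip)
qed

lemma select_com_runs: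
  assumes "env s"
  shows "runs select_com s (\<lambda>s'. (imem s' 23 0, imem s' 24 0, rmem s' 3 0) =
    select (aset s 4) (aset s 6) (row s))"
proof -
  let ?g = "\<lambda>u. fold (select1 (aset s 4) (aset s 6) (row s) u)"
  let ?acc = "\<lambda>s'. (imem s' 23 0, imem s' 24 0, rmem s' 3 0)"
  let ?I = "\<lambda>k s'. ?acc s' = fold (\<lambda>u. ?g u [0..<n]) [0..<k] (0, 0, 0)"
  define s0 where "s0 = iset 24 0 0 (iset 23 0 0 (rset 3 0 0 s))"
  have s0: "env s0" "aset s0 4 = aset s 4" "aset s0 6 = aset s 6" "row s0 = row s"
    using assms by (auto simp: s0_def aset_def row_def fun_eq_iff)
  have "runs (FOR 20 (V 0) (FOR 21 (V 0) test_com)) s0 (\<lambda>s'. ?acc s' = select (aset s 4) (aset s 6) (row s))"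
  proof (rule runs_FOR[where N = n and I = ?I])
    fix k s1
    assume k: "k < n" and ag: "agree (FOR 20 (V 0) (FOR 21 (V 0) test_com)) s0 s1"
      and 20: "imem s1 20 0 = k" and I: "?I k s1"
    show "runs (FOR 21 (V 0) test_com) s1 (\<lambda>s'. ?I (Suc k) (iset 20 0 (Suc k) s'))"
    proof (rule runs_FOR[where N = n and
          I = "\<lambda>j s'. ?acc s' = ?g k [0..<j] (fold (\<lambda>u. ?g u [0..<n]) [0..<k] (0, 0, 0))"])
      fix j s2
      assume j: "j < n" and ag2: "agree (FOR 21 (V 0) test_com) s1 s2" and 21: "imem s2 21 0 = j"
        and J: "?acc s2 = ?g k [0..<j] (fold (\<lambda>u. ?g u [0..<n]) [0..<k] (0, 0, 0))"
      have env: "env s2" "imem s2 20 0 = k"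
        using s0 ag ag2 20 by (auto intro!: env_agree[OF env_agree[OF s0(1) ag] ag2] simp: agree_def)
      have "aset s2 4 = aset s 4" "aset s2 6 = aset s 6" "row s2 = row s"
        unfolding s0(2-4)[symmetric] using ag ag2 by (auto simp: agree_def aset_def row_def fun_eq_iff)
      with test_com_runs[OF env k 21 j]
      show "runs test_com s2 (\<lambda>s'. ?acc (iset 21 0 (Suc j) s') =
          ?g k [0..<Suc j] (fold (\<lambda>u. ?g u [0..<n]) [0..<k] (0, 0, 0)))"
        using J by simp
    next
      fix s2 assume "agree (FOR 21 (V 0) test_com) s1 s2"
      then show "ival (V 0) s2 = n"
        using env_0[OF s0(1)] ag by (simp add: agree_def)
    qed (use I n_le_pow in simp_all)
  next
    fix s1 assume "agree (FOR 20 (V 0) (FOR 21 (V 0) test_com)) s0 s1"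
    then show "ival (V 0) s1 = n"
      using env_0[OF s0(1)] by (simp add: agree_def)
  qed (use n_le_pow in \<open>simp_all add: select_def s0_def\<close>)
  then show ?thesis
    unfolding select_com_def s0_def by (auto intro!: runs_Seq runs_ISet runs_RSet)
qed

lemma grow_com_runs:
  assumes "env s"
  shows "runs grow_com s (\<lambda>s'. (aset s' 6, row s') = grow (aset s 4) (aset s 6, row s))"
  unfolding grow_com_def
proof (rule runs_Seq, rule runs_conseq[OF select_com_runs[OF assms]])
  fix s1 assume ag: "agree select_com s s1"
    and sel': "(imem s1 23 0, imem s1 24 0, rmem s1 3 0) = select (aset s 4) (aset s 6) (row s)"
  define u v where "u = imem s1 23 0" and "v = imem s1 24 0"
  have sel: "select (aset s 4) (aset s 6) (row s) = (u, v, rmem s1 3 0)"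
    using sel' by (simp add: u_def v_def)
  have env: "env s1" by (rule env_agree[OF assms ag]) simp
  have eq: "aset s1 6 = aset s 6" "row s1 = row s"
    using ag by (auto simp: agree_def aset_def row_def fun_eq_iff)
  let ?copy = "FOR 22 (V 0) (ISet 5 (IAdd (IGet 3 (V 24)) (V 22)) (entry 5 (V 23) (V 22)))"
  let ?Q = "\<lambda>s'. (aset s' 6, row s') = grow (aset s 4) (aset s 6, row s)"
  show "runs (If (RLess (RNat (INum 0)) (RGet 3 (INum 0)))
     (Seq ?copy (Seq (ISet 5 (IAdd (IGet 3 (V 24)) (V 24)) (INum 1)) (ISet 6 (V 24) (INum 1))))
     Skip) s1 ?Q"
  proof (rule runs_If)
    assume "bval n f (RLess (RNat (INum 0)) (RGet 3 (INum 0))) s1"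
    then have pos: "0 < rmem s1 3 0" by simp
    have "valid (aset s 6) u v"
      by (rule select_props(1)[OF row_subset aset_subset sel pos])
    \<comment> \<open>\<open>u \<noteq> v\<close> matters for the copy: the row being read is not
      the one being overwritten.\<close>
    then have uv: "u < n" "v < n" "u \<noteq> v"
      using adj_lt[of u v] by (auto simp: valid_def)
    have grow: "grow (aset s 4) (aset s 6, row s) = (insert v (aset s1 6), (row s1)(v := insert v (row s1 u)))"
      using sel pos by (simp add: grow_def eq)
    show "runs (Seq ?copy (Seq (ISet 5 (IAdd (IGet 3 (V 24)) (V 24)) (INum 1)) (ISet 6 (V 24) (INum 1)))) s1 ?Q"
    proof (rule runs_Seq, rule runs_FOR[where N = n and I = "\<lambda>k s'. \<forall>w<n. \<forall>x<n. imem s' 5 (w * n + x) =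
        (if w = v \<and> x < k then imem s1 5 (u * n + x) else imem s1 5 (w * n + x))"])
      fix k s2 assume "k < n" "agree ?copy s1 s2" "imem s2 22 0 = k"
        "\<forall>w<n. \<forall>x<n. imem s2 5 (w * n + x) =
          (if w = v \<and> x < k then imem s1 5 (u * n + x) else imem s1 5 (w * n + x))"
      then show "runs (ISet 5 (IAdd (IGet 3 (V 24)) (V 22)) (entry 5 (V 23) (V 22))) s2
          (\<lambda>s2. \<forall>w<n. \<forall>x<n. imem (iset 22 0 (Suc k) s2) 5 (w * n + x) =
          (if w = v \<and> x < Suc k then imem s1 5 (u * n + x) else imem s1 5 (w * n + x)))"
        using uv env_3[OF env] by (intro runs_ISet) (auto simp: agree_def u_def v_def index_eq less_Suc_eq)
    next
      fix s2 assume "agree ?copy s1 s2"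
        "\<forall>w<n. \<forall>x<n. imem s2 5 (w * n + x) =
          (if w = v \<and> x < n then imem s1 5 (u * n + x) else imem s1 5 (w * n + x))"
      then show "runs (Seq (ISet 5 (IAdd (IGet 3 (V 24)) (V 24)) (INum 1)) (ISet 6 (V 24) (INum 1))) s2 ?Q"
        using uv env_3[OF env] unfolding grow
        by (intro runs_Seq runs_ISet)
          (auto simp: agree_def aset_def row_def fun_eq_iff index_eq u_def[symmetric] v_def[symmetric])
    qed (use env_0[OF env] n_le_pow in \<open>auto simp: agree_def\<close>)
  next
    assume "\<not> bval n f (RLess (RNat (INum 0)) (RGet 3 (INum 0))) s1"
    then show "runs Skip s1 ?Q"
      using sel by (intro runs_Skip) (simp add: grow_def eq)
  qed
qed

lemma tree_com_runs:
  assumes "env s" "imem s 25 0 = v" "v < n"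
  shows "runs tree_com s (\<lambda>s'. (aset s' 6, row s') = tree v (aset s 4))"
proof -
  let ?row = "FOR 21 (V 0) (ISet 5 (IAdd (IGet 3 (V 20)) (V 21)) (INum 0))"
  let ?clear = "FOR 20 (V 0) (Seq (ISet 6 (V 20) (INum 0)) ?row)"
  let ?Z = "\<lambda>k s'. \<forall>w<k. imem s' 6 w = 0 \<and> (\<forall>x<n. imem s' 5 (w * n + x) = 0)"
  have 1: "runs ?clear s (?Z n)"
  proof (rule runs_FOR[where N = n and I = ?Z])
    fix k s1 assume k: "k < n" "agree ?clear s s1" "imem s1 20 0 = k" "?Z k s1"
    show "runs (Seq (ISet 6 (V 20) (INum 0)) ?row) s1 (\<lambda>s'. ?Z (Suc k) (iset 20 0 (Suc k) s'))"
    proof (rule runs_Seq, rule runs_ISet, rule runs_FOR[where N = n and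
          I = "\<lambda>j s'. ?Z k s' \<and> imem s' 6 k = 0 \<and> (\<forall>x<j. imem s' 5 (k * n + x) = 0)"])
      fix j s2 assume "j < n" "agree ?row (iset 6 (ival (V 20) s1) (ival (INum 0) s1) s1) s2"
        "imem s2 21 0 = j" "?Z k s2 \<and> imem s2 6 k = 0 \<and> (\<forall>x<j. imem s2 5 (k * n + x) = 0)"
      then show "runs (ISet 5 (IAdd (IGet 3 (V 20)) (V 21)) (INum 0)) s2 (\<lambda>s3.
          ?Z k (iset 21 0 (Suc j) s3) \<and> imem (iset 21 0 (Suc j) s3) 6 k = 0 \<and>
          (\<forall>x<Suc j. imem (iset 21 0 (Suc j) s3) 5 (k * n + x) = 0))"
        using k env_3[OF assms(1) k(1)] by (intro runs_ISet) (auto simp: agree_def less_Suc_eq)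
    qed (use k env_0[OF assms(1)] n_le_pow in \<open>auto simp: agree_def less_Suc_eq\<close>)
  qed (use env_0[OF assms(1)] n_le_pow in \<open>auto simp: agree_def\<close>)
  have 2: "runs (Seq (ISet 6 (V 25) (INum 1)) (Seq (ISet 5 (IAdd (IGet 3 (V 25)) (V 25)) (INum 1))
      (FOR 26 (V 0) grow_com))) s1 (\<lambda>s'. (aset s' 6, row s') = tree v (aset s 4))"
    if ag: "agree ?clear s s1" and Z: "?Z n s1" for s1
  proof -
    have "env s1" by (rule env_agree[OF assms(1) ag]) simp
    define s2 where "s2 = iset 5 (v * n + v) 1 (iset 6 v 1 s1)"
    have s2: "env s2" "aset s2 4 = aset s 4" "aset s2 6 = {v}" "row s2 = (\<lambda>_. {})(v := {v})"
      using \<open>env s1\<close> ag Z assms(3)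
      by (auto simp: s2_def aset_def row_def agree_def fun_eq_iff index_eq)
    have "runs (FOR 26 (V 0) grow_com) s2 (\<lambda>s'. (aset s' 6, row s') = tree v (aset s 4))"
    proof (rule runs_FOR[where N = n and
          I = "\<lambda>k s'. (aset s' 6, row s') = (grow (aset s 4) ^^ k) ({v}, (\<lambda>_. {})(v := {v}))"])
      fix k s3 assume ag: "agree (FOR 26 (V 0) grow_com) s2 s3"
        and I: "(aset s3 6, row s3) = (grow (aset s 4) ^^ k) ({v}, (\<lambda>_. {})(v := {v}))"
      have "env s3" by (rule env_agree[OF s2(1) ag]) simp
      have "aset s3 4 = aset s 4"
        using aset_agree[OF ag, of 4] s2(2) by simp
      then show "runs grow_com s3 (\<lambda>s'. (aset (iset 26 0 (Suc k) s') 6, row (iset 26 0 (Suc k) s')) =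
          (grow (aset s 4) ^^ Suc k) ({v}, (\<lambda>_. {})(v := {v})))"
        using grow_com_runs[OF \<open>env s3\<close>] I by simp
    next
      fix s3 assume "agree (FOR 26 (V 0) grow_com) s2 s3"
      then show "ival (V 0) s3 = n" using env_0[OF s2(1)] by (simp add: agree_def)
    next
      show "(aset (iset 26 0 0 s2) 6, row (iset 26 0 0 s2)) =
          (grow (aset s 4) ^^ 0) ({v}, (\<lambda>_. {})(v := {v}))"
        using s2(3,4) by simp
    qed (use n_le_pow in \<open>auto simp: tree_def\<close>)
    moreover have "imem s1 25 0 = v" "imem s1 3 v = v * n"
      using ag assms env_3[OF \<open>env s1\<close>] by (auto simp: agree_def)
    ultimately show ?thesis
      unfolding s2_def by (auto intro!: runs_Seq runs_ISet)
  qed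
  show ?thesis
    unfolding tree_com_def by (rule runs_Seq, rule runs_conseq[OF 1], rule 2)
qed

lemma add_path_com_runs:
  assumes "env s" "imem s x 0 = v" "v < n" "x \<notin> {4, 22}"
  shows "runs (add_path_com x) s (\<lambda>s'. aset s' 4 = aset s 4 \<union> row s v)"
  unfolding add_path_com_def
proof (rule runs_FOR[where N = n and I = "\<lambda>k s'. \<forall>y<n. imem s' 4 y =
    (if y < k then imem s 4 y + imem s 5 (v * n + y) else imem s 4 y)"])
qed (use assms env_0 env_3 n_le_pow in
    \<open>auto simp: agree_def less_Suc_eq aset_def row_def intro!: runs_ISet\<close>)

section \<open>Decoding a code and executing its rounds\<close>

lemma digit_com_runs:
  assumes "env s" "imem s 28 0 = c" "c \<le> n ^ a" "x \<notin> {0, 28, 29}"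
  shows "runs (digit_com x) s (\<lambda>s'. imem s' x 0 = c mod n \<and> imem s' 28 0 = c div n)"
  unfolding digit_com_def
proof (rule runs_Seq, rule runs_ISet, rule runs_Seq, rule runs_While[where N = c and
    I = "\<lambda>k s'. imem s' 29 0 = k \<and> imem s' 28 0 + k * n = c"])
  let ?loop = "Seq (set_var 28 (ISub (V 28) (V 0))) (set_var 29 (IAdd (V 29) (INum 1)))"
  let ?s = "iset 29 (ival (INum 0) s) (ival (INum 0) s) s"
  fix k s' assume ag: "agree ?loop ?s s'" and I: "imem s' 29 0 = k \<and> imem s' 28 0 + k * n = c"
  have n: "imem s' 0 0 = n" using ag env_0[OF assms(1)] by (simp add: agree_def)
  {
    assume "bval n f (BNot (ILess (V 28) (V 0))) s'"
    then have ge: "n \<le> imem s' 28 0" using n by simp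
    have "k + 1 \<le> n + k * n" using n3 by (cases n) auto
    then have "k < c" using I ge by linarith
    with ge show "k < c \<and> runs ?loop s' (\<lambda>s'. imem s' 29 0 = Suc k \<and> imem s' 28 0 + Suc k * n = c)"
      using I n by (intro conjI runs_Seq runs_ISet) simp_all
  next
    assume "\<not> bval n f (BNot (ILess (V 28) (V 0))) s'"
    then have "imem s' 28 0 < n" using n by simp
    then have "c mod n = imem s' 28 0" "c div n = imem s' 29 0"
      using I by auto
    then show "runs (Seq (set_var x (V 28)) (set_var 28 (V 29))) s'
        (\<lambda>s'. imem s' x 0 = c mod n \<and> imem s' 28 0 = c div n)"
      using assms(4) by (intro runs_Seq runs_ISet) simp
  }
qed (use assms in auto)

lemma extend_com_runs:
  assumes "env s" "imem s 28 0 = c" "c \<le> n ^ a"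
  shows "runs extend_com s (\<lambda>s'. imem s' 28 0 = c div n div n div n \<and>
    aset s' 4 = extend (c mod n) (c div n mod n) (c div n div n mod n) (aset s 4))"
proof -
  define u0 u1 u2 where "u0 = c mod n" and "u1 = c div n mod n" and "u2 = c div n div n mod n"
  have lt: "u0 < n" "u1 < n" "u2 < n" using n3 by (auto simp: u0_def u1_def u2_def)
  let ?X = "insert u0 (aset s 4)"
  show ?thesis
    unfolding extend_com_def u0_def[symmetric] u1_def[symmetric] u2_def[symmetric]
  proof (rule runs_Seq, rule runs_conseq[OF digit_com_runs[OF assms]], simp)
    fix s1 assume ag: "agree (digit_com 25) s s1" and 1: "imem s1 25 0 = c mod n \<and> imem s1 28 0 = c div n"
    have env: "env s1" by (rule env_agree[OF assms(1) ag]) simp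
    have c: "c div n \<le> n ^ a" using assms(3) div_le_dividend le_trans by blast
    have s1: "imem s1 25 0 = u0" "aset s1 4 = aset s 4"
      using 1 ag by (auto simp: agree_def aset_def u0_def)
    show "runs (Seq (digit_com 30) (Seq (digit_com 31)
      (Seq (ISet 4 (V 25) (INum 1)) (Seq tree_com (Seq (add_path_com 30) (add_path_com 31)))))) s1
      (\<lambda>s'. imem s' 28 0 = c div n div n div n \<and> aset s' 4 = extend u0 u1 u2 (aset s 4))"
    proof (rule runs_Seq, rule runs_conseq[OF digit_com_runs[OF env _ c]], use 1 in simp, simp)
      fix s2 assume ag: "agree (digit_com 30) s1 s2"
        and 2: "imem s2 30 0 = c div n mod n \<and> imem s2 28 0 = c div n div n"
      have env: "env s2" by (rule env_agree[OF env ag]) simp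
      have c: "c div n div n \<le> n ^ a" using c div_le_dividend le_trans by blast
      have s2: "imem s2 25 0 = u0" "imem s2 30 0 = u1" "aset s2 4 = aset s 4"
        using 2 s1 ag by (auto simp: agree_def aset_def u1_def)
      show "runs (Seq (digit_com 31)
        (Seq (ISet 4 (V 25) (INum 1)) (Seq tree_com (Seq (add_path_com 30) (add_path_com 31))))) s2
        (\<lambda>s'. imem s' 28 0 = c div n div n div n \<and> aset s' 4 = extend u0 u1 u2 (aset s 4))"
      proof (rule runs_Seq, rule runs_conseq[OF digit_com_runs[OF env _ c]], use 2 in simp, simp,
          rule runs_Seq, rule runs_ISet, rule runs_Seq)
        fix s3 assume ag: "agree (digit_com 31) s2 s3"
          and 3: "imem s3 31 0 = c div n div n mod n \<and> imem s3 28 0 = c div n div n div n"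
        define s4 where "s4 = iset 4 (ival (V 25) s3) (ival (INum 1) s3) s3"
        have env: "env s4" using env_agree[OF env ag] by (simp add: s4_def)
        have s4: "imem s4 25 0 = u0" "imem s4 30 0 = u1" "imem s4 31 0 = u2" "aset s4 4 = ?X"
          "imem s4 28 0 = c div n div n div n"
          using 3 s2 ag lt by (auto simp: agree_def aset_def u2_def s4_def)
        show "runs tree_com s4 (\<lambda>s'. runs (Seq (add_path_com 30) (add_path_com 31)) s'
            (\<lambda>s'. imem s' 28 0 = c div n div n div n \<and> aset s' 4 = extend u0 u1 u2 (aset s 4)))"
        proof (rule runs_conseq[OF tree_com_runs[OF env s4(1) lt(1)]], rule runs_Seq)
          fix s5 assume ag: "agree tree_com s4 s5" and tree: "(aset s5 6, row s5) = tree u0 (aset s4 4)"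
          have env: "env s5" by (rule env_agree[OF env ag]) simp
          have s5: "imem s5 30 0 = u1" "imem s5 31 0 = u2" "aset s5 4 = ?X"
            "imem s5 28 0 = c div n div n div n"
            using s4 ag by (auto simp: agree_def aset_def)
          have p: "row s5 = snd (tree u0 ?X)"
            using tree s4(4) by (metis snd_conv)
          show "runs (add_path_com 30) s5 (\<lambda>s'. runs (add_path_com 31) s'
              (\<lambda>s'. imem s' 28 0 = c div n div n div n \<and> aset s' 4 = extend u0 u1 u2 (aset s 4)))"
          proof (rule runs_conseq[OF add_path_com_runs[OF env s5(1) lt(2)]], simp)
            fix s6 assume ag: "agree (add_path_com 30) s5 s6" and 6: "aset s6 4 = aset s5 4 \<union> row s5 u1"
            have env: "env s6" by (rule env_agree[OF env ag]) simp
            have s6: "imem s6 31 0 = u2" "row s6 = row s5" "imem s6 28 0 = c div n div n div n"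
              using s5 ag by (auto simp: agree_def row_def fun_eq_iff)
            show "runs (add_path_com 31) s6
              (\<lambda>s'. imem s' 28 0 = c div n div n div n \<and> aset s' 4 = extend u0 u1 u2 (aset s 4))"
              by (rule runs_conseq[OF add_path_com_runs[OF env s6(1) lt(3)]])
                (simp_all add: 6 s6 s5 p extend_def Let_def agree_def)
          qed
        qed
      qed
    qed
  qed
qed

text \<open>The invariant looks forward: the remaining \<open>K - k\<close> rounds, applied to the
  current code and set, give the intended result.\<close>

lemma run_com_runs:
  assumes "env s" "imem s 34 0 = K" "K \<le> n ^ a" "imem s 28 0 = c" "c \<le> n ^ a"
  shows "runs (FOR 33 (V 34) extend_com) s (\<lambda>s'. aset s' 4 = run K c (aset s 4))"
proof (rule runs_FOR[where N = K and I = "\<lambda>k s'. imem s' 28 0 \<le> n ^ a \<and>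
    run (K - k) (imem s' 28 0) (aset s' 4) = run K c (aset s 4)"])
  fix k s1 assume k: "k < K" and ag: "agree (FOR 33 (V 34) extend_com) s s1"
    and I: "imem s1 28 0 \<le> n ^ a \<and> run (K - k) (imem s1 28 0) (aset s1 4) = run K c (aset s 4)"
  define c1 where "c1 = imem s1 28 0"
  have env: "env s1" by (rule env_agree[OF assms(1) ag]) simp
  have c1: "c1 \<le> n ^ a" using I by (simp add: c1_def)
  have "c1 div n div n div n \<le> n ^ a"
    using c1 by (meson div_le_dividend le_trans)
  moreover have "run (K - k) c1 (aset s1 4) = run K c (aset s 4)"
    using I by (simp add: c1_def)
  then have "run (K - Suc k) (c1 div n div n div n)
      (extend (c1 mod n) (c1 div n mod n) (c1 div n div n mod n) (aset s1 4)) = run K c (aset s 4)"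
    using k by (simp add: Suc_diff_Suc flip: run.simps(2))
  ultimately show "runs extend_com s1 (\<lambda>s'. imem (iset 33 0 (Suc k) s') 28 0 \<le> n ^ a \<and>
      run (K - Suc k) (imem (iset 33 0 (Suc k) s') 28 0) (aset (iset 33 0 (Suc k) s') 4) = run K c (aset s 4))"
    by (intro runs_conseq[OF extend_com_runs[OF env c1_def[symmetric] c1]]) simp
qed (use assms in \<open>auto simp: agree_def\<close>)

section \<open>Cores and the best candidate\<close>

lemma degree_com_runs:
  assumes "env s" "imem s 21 0 = v" "v < n"
  shows "runs degree_com s (\<lambda>s'. imem s' 23 0 = card {w \<in> aset s 8. adj v w})"
  unfolding degree_com_def
proof (rule runs_Seq, rule runs_ISet, rule runs_FOR[where N = n and
    I = "\<lambda>k s'. imem s' 23 0 = card {w. w < k \<and> w \<in> aset s 8 \<and> adj v w}"])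
  let ?body = "If (BAnd (pos (IGet 8 (V 22))) (pos (entry 1 (V 21) (V 22))))
       (set_var 23 (IAdd (V 23) (INum 1))) Skip"
  let ?s = "iset 23 (ival (INum 0) s) (ival (INum 0) s) s"
  let ?S = "\<lambda>k. {w. w < k \<and> w \<in> aset s 8 \<and> adj v w}"
  fix k s1 assume k: "k < n" and ag: "agree (FOR 22 (V 0) ?body) ?s s1" and 22: "imem s1 22 0 = k"
    and I: "imem s1 23 0 = card (?S k)"
  have env: "env s1" by (rule env_agree[OF _ ag]) (use assms in simp_all)
  have b: "bval n f (BAnd (pos (IGet 8 (V 22))) (pos (entry 1 (V 21) (V 22)))) s1 \<longleftrightarrow> k \<in> aset s 8 \<and> adj v k"
    using ag k 22 assms env_1[OF env] env_3[OF env] by (auto simp: agree_def aset_def)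
  have S: "?S (Suc k) = (if k \<in> aset s 8 \<and> adj v k then insert k (?S k) else ?S k)"
    by (auto simp: less_Suc_eq)
  show "runs ?body s1 (\<lambda>s'. imem (iset 22 0 (Suc k) s') 23 0 = card (?S (Suc k)))"
    by (rule runs_If; unfold b; intro runs_ISet runs_Skip; unfold S; simp add: I)
next
  let ?body = "If (BAnd (pos (IGet 8 (V 22))) (pos (entry 1 (V 21) (V 22))))
       (set_var 23 (IAdd (V 23) (INum 1))) Skip"
  fix s1 assume "imem s1 23 0 = card {w. w < n \<and> w \<in> aset s 8 \<and> adj v w}"
  moreover have "{w. w < n \<and> w \<in> aset s 8 \<and> adj v w} = {w \<in> aset s 8. adj v w}"
    using aset_subset by auto
  ultimately show "imem s1 23 0 = card {w \<in> aset s 8. adj v w}" by simp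
qed (use assms env_0 n_le_pow in \<open>auto simp: agree_def\<close>)

lemma core_com_runs:
  assumes "env s"
  shows "runs core_com s (\<lambda>s'. aset s' 8 = core (aset s 4))"
proof -
  let ?peel1 = "Seq degree_com (If (ILess (V 23) (INum 2)) (ISet 8 (V 21) (INum 0)) Skip)"
  let ?outer = "FOR 20 (V 0) (FOR 21 (V 0) ?peel1)"
  let ?copy = "FOR 20 (V 0) (ISet 8 (V 20) (IGet 4 (V 20)))"
  have copy: "runs ?copy s (\<lambda>s'. aset s' 8 = aset s 4)"
    by (rule runs_FOR[where N = n and I = "\<lambda>k s'. \<forall>v<k. imem s' 8 v = imem s 4 v"])
      (use assms env_0 n_le_pow in \<open>auto simp: agree_def aset_def less_Suc_eq intro!: runs_ISet\<close>)
  have 1: "runs ?peel1 s1 (\<lambda>s'. aset s' 8 = peel1 v (aset s1 8))"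
    if "env s1" "imem s1 21 0 = v" "v < n" for s1 v
  proof (rule runs_Seq, rule runs_conseq[OF degree_com_runs[OF that]])
    fix s2 assume ag: "agree degree_com s1 s2" and 23: "imem s2 23 0 = card {w \<in> aset s1 8. adj v w}"
    have "aset s2 8 = aset s1 8" by (rule aset_agree[OF ag]) simp
    moreover have "imem s2 21 0 = v" using ag that by (simp add: agree_def)
    moreover have "aset (iset 8 v 0 s2) 8 = aset s2 8 - {v}"
      by (auto simp: aset_def)
    ultimately show "runs (If (ILess (V 23) (INum 2)) (ISet 8 (V 21) (INum 0)) Skip) s2
        (\<lambda>s'. aset s' 8 = peel1 v (aset s1 8))"
      by (intro runs_If runs_ISet runs_Skip) (simp_all add: 23 peel1_def)
  qed
  have "runs ?outer s0 (\<lambda>s'. aset s' 8 = core (aset s 4))"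
    if ag0: "agree ?copy s s0" and s0: "aset s0 8 = aset s 4" for s0
  proof (rule runs_FOR[where N = n and I = "\<lambda>k s'. aset s' 8 = (peel ^^ k) (aset s 4)"])
    have env0: "env s0" by (rule env_agree[OF assms ag0]) simp
    {
      fix k s1 assume ag1: "agree ?outer s0 s1" and I: "aset s1 8 = (peel ^^ k) (aset s 4)"
      have env1: "env s1" by (rule env_agree[OF env0 ag1]) simp
      show "runs (FOR 21 (V 0) ?peel1) s1 (\<lambda>s'. aset (iset 20 0 (Suc k) s') 8 = (peel ^^ Suc k) (aset s 4))"
      proof (rule runs_FOR[where N = n and
            I = "\<lambda>j s'. aset s' 8 = fold peel1 [0..<j] ((peel ^^ k) (aset s 4))"])
        fix j s2 assume j: "j < n" "imem s2 21 0 = j" and ag2: "agree (FOR 21 (V 0) ?peel1) s1 s2"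
          and J: "aset s2 8 = fold peel1 [0..<j] ((peel ^^ k) (aset s 4))"
        have env2: "env s2" by (rule env_agree[OF env1 ag2]) simp
        show "runs ?peel1 s2 (\<lambda>s'. aset (iset 21 0 (Suc j) s') 8 =
            fold peel1 [0..<Suc j] ((peel ^^ k) (aset s 4)))"
          by (rule runs_conseq[OF 1[OF env2 j(2,1)]]) (simp add: J)
      next
        fix s2 assume "agree (FOR 21 (V 0) ?peel1) s1 s2"
        then show "ival (V 0) s2 = n" using env_0[OF env1] by (simp add: agree_def)
      qed (use I n_le_pow in \<open>simp_all add: peel_def\<close>)
    next
      fix s1 assume "agree ?outer s0 s1"
      then show "ival (V 0) s1 = n" using env_0[OF env0] by (simp add: agree_def)
    }
  qed (use s0 n_le_pow in \<open>simp_all add: core_def\<close>)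
  then show ?thesis
    unfolding core_com_def by (intro runs_Seq runs_conseq[OF copy])
qed

lemma nonempty_com_runs:
  assumes "env s"
  shows "runs nonempty_com s (\<lambda>s'. 0 < imem s' 23 0 \<longleftrightarrow> aset s 8 \<noteq> {})"
  unfolding nonempty_com_def
  by (rule runs_Seq, rule runs_ISet, rule runs_FOR[where N = n and
        I = "\<lambda>k s'. 0 < imem s' 23 0 \<longleftrightarrow> (\<exists>v<k. 0 < imem s 8 v)"])
    (use assms env_0 n_le_pow in \<open>auto simp: agree_def aset_def less_Suc_eq intro!: runs_If runs_ISet runs_Skip\<close>)

lemma update_com_runs:
  assumes "env s"
  shows "runs update_com s (\<lambda>s'.
    if 0 < imem s 23 0 \<and> rmem s 4 0 < score (aset s 8)
    then rmem s' 4 0 = score (aset s 8) \<and> aset s' 9 = aset s 8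
    else rmem s' 4 0 = rmem s 4 0 \<and> aset s' 9 = aset s 9)"
  unfolding update_com_def
proof (rule runs_If)
  let ?copy = "FOR 20 (V 0) (ISet 9 (V 20) (IGet 8 (V 20)))"
  assume b: "bval n f (BAnd (pos (V 23)) (RLess (RGet 4 (INum 0)) (score_exp 8))) s"
  have "runs ?copy (rset 4 0 (score (aset s 8)) s)
      (\<lambda>s'. rmem s' 4 0 = score (aset s 8) \<and> aset s' 9 = aset s 8)"
    by (rule runs_FOR[where N = n and I = "\<lambda>k s'. \<forall>v<k. imem s' 9 v = imem s 8 v"])
      (use assms env_0 n_le_pow in \<open>auto simp: agree_def aset_def less_Suc_eq intro!: runs_ISet\<close>)
  then show "runs (Seq (RSet 4 (INum 0) (score_exp 8)) ?copy) s (\<lambda>s'.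
    if 0 < imem s 23 0 \<and> rmem s 4 0 < score (aset s 8)
    then rmem s' 4 0 = score (aset s 8) \<and> aset s' 9 = aset s 8
    else rmem s' 4 0 = rmem s 4 0 \<and> aset s' 9 = aset s 9)"
    using b by (intro runs_Seq runs_RSet) simp
qed (auto intro!: runs_Skip)

lemma candidate_com_runs:
  assumes "env s" "imem s 34 0 = K" "K \<le> n ^ a" "imem s 32 0 = c" "c \<le> n ^ a"
    and Y: "Y = core (run K c {})"
  shows "runs candidate_com s (\<lambda>s'.
    if Y \<noteq> {} \<and> rmem s 4 0 < score Y
    then rmem s' 4 0 = score Y \<and> aset s' 9 = Y
    else rmem s' 4 0 = rmem s 4 0 \<and> aset s' 9 = aset s 9)"
proof -
  let ?Q = "\<lambda>s'. if Y \<noteq> {} \<and> rmem s 4 0 < score Y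
    then rmem s' 4 0 = score Y \<and> aset s' 9 = Y
    else rmem s' 4 0 = rmem s 4 0 \<and> aset s' 9 = aset s 9"
  let ?clear = "FOR 20 (V 0) (ISet 4 (V 20) (INum 0))"
  have clear: "runs ?clear s (\<lambda>s'. aset s' 4 = {})"
    by (rule runs_FOR[where N = n and I = "\<lambda>k s'. \<forall>v<k. imem s' 4 v = 0"])
      (use assms env_0 n_le_pow in \<open>auto simp: agree_def aset_def less_Suc_eq intro!: runs_ISet\<close>)
  show ?thesis
    unfolding candidate_com_def
  proof (rule runs_Seq, rule runs_conseq[OF clear], rule runs_Seq, rule runs_ISet, rule runs_Seq)
    fix s1 assume ag1: "agree ?clear s s1" and s1: "aset s1 4 = {}"
    let ?s1 = "iset 28 (ival (INum 0) s1) (ival (V 32) s1) s1"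
    have env1: "env s1" by (rule env_agree[OF assms(1) ag1]) simp
    have vals: "env ?s1" "imem ?s1 34 0 = K" "imem ?s1 28 0 = c"
      using env1 ag1 assms by (auto simp: agree_def)
    show "runs (FOR 33 (V 34) extend_com) ?s1 (\<lambda>s'. runs (Seq core_com (Seq nonempty_com update_com)) s' ?Q)"
    proof (rule runs_conseq[OF run_com_runs[OF vals(1,2) assms(3) vals(3) assms(5)]], rule runs_Seq)
      fix s2 assume ag2: "agree (FOR 33 (V 34) extend_com) ?s1 s2"
        and "aset s2 4 = run K c (aset ?s1 4)"
      then have s2: "aset s2 4 = run K c {}" using s1 by simp
      have env2: "env s2" by (rule env_agree[OF vals(1) ag2]) simp
      show "runs core_com s2 (\<lambda>s'. runs (Seq nonempty_com update_com) s' ?Q)"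
      proof (rule runs_conseq[OF core_com_runs[OF env2]], rule runs_Seq)
        fix s3 assume ag3: "agree core_com s2 s3" and "aset s3 8 = core (aset s2 4)"
        then have s3: "aset s3 8 = Y" using s2 Y by simp
        have env3: "env s3" by (rule env_agree[OF env2 ag3]) simp
        show "runs nonempty_com s3 (\<lambda>s'. runs update_com s' ?Q)"
        proof (rule runs_conseq[OF nonempty_com_runs[OF env3]])
          fix s4 assume ag4: "agree nonempty_com s3 s4" and 23: "0 < imem s4 23 0 \<longleftrightarrow> aset s3 8 \<noteq> {}"
          have env4: "env s4" by (rule env_agree[OF env3 ag4]) simp
          have s4: "aset s4 8 = Y"
            using aset_agree[OF ag4, of 8] s3 by simp
          have "aset s4 9 = aset s 9"
            using aset_agree[OF ag4, of 9] aset_agree[OF ag3, of 9] aset_agree[OF ag2, of 9]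
              aset_agree[OF ag1, of 9] by simp
          moreover have "rmem s4 4 0 = rmem s 4 0"
            using ag1 ag2 ag3 ag4 by (simp add: agree_def)
          ultimately show "runs update_com s4 ?Q"
            by (intro runs_conseq[OF update_com_runs[OF env4]]) (simp add: 23 s3 s4)
        qed
      qed
    qed
  qed
qed

text \<open>The record 0 is the initial memory. Once a nonempty core has been met, its positive
  score rules out that case, and the record belongs to the stored set.\<close>

definition best :: "nat \<Rightarrow> nat \<Rightarrow> state \<Rightarrow> bool" where
  "best K c s \<longleftrightarrow>
     (\<forall>c'<c. core (run K c' {}) \<noteq> {} \<longrightarrow> score (core (run K c' {})) \<le> rmem s 4 0) \<and>
     (rmem s 4 0 = 0 \<or> aset s 9 \<noteq> {} \<and> stable (aset s 9) \<and> rmem s 4 0 = score (aset s 9))"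

lemma search_com_runs:
  assumes "env s" "imem s 34 0 = K" "K \<le> n ^ a" "rmem s 2 0 = real N" "N \<le> n ^ a" "rmem s 4 0 = 0"
    and stable: "\<And>c. stable (core (run K c {}))"
  shows "runs search_com s (best K N)"
  unfolding search_com_def
proof (rule runs_Seq, rule runs_ISet, rule runs_While[where N = N and
    I = "\<lambda>k s'. k \<le> N \<and> imem s' 32 0 = k \<and> best K k s'"])
  let ?body = "Seq candidate_com (set_var 32 (IAdd (V 32) (INum 1)))"
  let ?s = "iset 32 (ival (INum 0) s) (ival (INum 0) s) s"
  show "0 \<le> N \<and> imem ?s 32 0 = 0 \<and> best K 0 ?s"
    using assms(6) by (simp add: best_def)
  show "N \<le> n ^ a" by fact
  fix k s1 assume ag: "agree ?body ?s s1" and I: "k \<le> N \<and> imem s1 32 0 = k \<and> best K k s1"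
  have env: "env s1" by (rule env_agree[OF _ ag]) (use assms in simp_all)
  have vals: "imem s1 34 0 = K" "rmem s1 2 0 = real N"
    using ag assms by (simp_all add: agree_def)
  {
    assume "bval n f (RLess (RNat (V 32)) (RGet 2 (INum 0))) s1"
    then have k: "k < N" using I vals by simp
    then have "k \<le> n ^ a" using assms(5) by simp
    let ?Y = "core (run K k {})"
    have "runs ?body s1 (\<lambda>s'. Suc k \<le> N \<and> imem s' 32 0 = Suc k \<and> best K (Suc k) s')"
    proof (rule runs_Seq, rule runs_conseq[OF candidate_com_runs[OF env vals(1) assms(3) _ \<open>k \<le> n ^ a\<close> refl]],
        use I in simp, rule runs_ISet)
      fix s2 assume ag2: "agree candidate_com s1 s2" and
        2: "if ?Y \<noteq> {} \<and> rmem s1 4 0 < score ?Y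
            then rmem s2 4 0 = score ?Y \<and> aset s2 9 = ?Y
            else rmem s2 4 0 = rmem s1 4 0 \<and> aset s2 9 = aset s1 9"
      have "best K (Suc k) s2"
      proof (cases "?Y \<noteq> {} \<and> rmem s1 4 0 < score ?Y")
        case True
        then show ?thesis
          using I 2 stable[of k] unfolding best_def by (auto simp: less_Suc_eq intro: order_trans[OF _ less_imp_le])
      next
        case False
        then show ?thesis
          using I 2 unfolding best_def by (auto simp: less_Suc_eq)
      qed
      moreover have "imem s2 32 0 = k" using ag2 I by (simp add: agree_def)
      ultimately show "Suc k \<le> N \<and>
          imem (iset 32 (ival (INum 0) s2) (ival (IAdd (V 32) (INum 1)) s2) s2) 32 0 = Suc k \<and>
          best K (Suc k) (iset 32 (ival (INum 0) s2) (ival (IAdd (V 32) (INum 1)) s2) s2)"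
        using k by (simp add: best_def)
    qed
    with k show "k < N \<and> runs ?body s1 (\<lambda>s'. Suc k \<le> N \<and> imem s' 32 0 = Suc k \<and> best K (Suc k) s')"
      by simp
  next
    assume "\<not> bval n f (RLess (RNat (V 32)) (RGet 2 (INum 0))) s1"
    then have "k = N" using I vals by simp
    then show "best K N s1" using I by simp
  }
qed

section \<open>Number of rounds, closing walk and the whole program\<close>

lemma init_com_runs:
  assumes m: "1 \<le> \<epsilon> * 2 ^ m" "\<And>k. k < m \<Longrightarrow> \<epsilon> * 2 ^ k < 1" "m \<le> n ^ a"
  shows "runs init_com (input_state n G \<epsilon>) (\<lambda>s. env s \<and> imem s 34 0 = Suc m \<and> rmem s 2 0 = real (n ^ (3 * Suc m)))"
proof -
  let ?s = "input_state n G \<epsilon>"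
  let ?offsets = "FOR 20 (V 0) (ISet 3 (IAdd (V 20) (INum 1)) (IAdd (IGet 3 (V 20)) (V 0)))"
  let ?body = "Seq (RSet 1 (INum 0) (RAdd (RGet 1 (INum 0)) (RGet 1 (INum 0))))
    (Seq (RSet 2 (INum 0) (RMul (RGet 2 (INum 0)) (RMul (RNat (V 0)) (RMul (RNat (V 0)) (RNat (V 0))))))
      (set_var 34 (IAdd (V 34) (INum 1))))"
  have power6: "real n ^ 6 = real n * (real n * (real n * (real n * (real n * real n))))"
    by (simp add: eval_nat_numeral)
  let ?Q = "\<lambda>s. env s \<and> imem s 34 0 = Suc m \<and> rmem s 2 0 = real (n ^ (3 * Suc m))"
  have offsets: "runs ?offsets ?s (\<lambda>s. \<forall>u\<le>n. imem s 3 u = u * n)"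
    by (rule runs_FOR[where N = n and I = "\<lambda>k s'. \<forall>u\<le>k. imem s' 3 u = u * n"])
      (use n_le_pow in \<open>auto simp: agree_def input_state_def le_Suc_eq intro!: runs_ISet\<close>)
  show ?thesis
    unfolding init_com_def
  proof (rule runs_Seq, rule runs_conseq[OF offsets])
    fix s1 assume ag1: "agree ?offsets ?s s1" and 3: "\<forall>u\<le>n. imem s1 3 u = u * n"
    have adj: "0 < imem s1 1 (u * n + v) \<longleftrightarrow> adj u v" if "u < n" "v < n" for u v
    proof -
      have "u * n + v < u * n + n" using that by simp
      also have "\<dots> \<le> n * n" using that mult_le_mono1[of "Suc u" n n] by simp
      finally show ?thesis
        using ag1 that by (simp add: agree_def input_state_def)
    qed
    have env1: "env s1"
      using ag1 3 adj by (auto simp: env_def agree_def input_state_def)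
    define s2 where "s2 = iset 34 0 1 (rset 2 0 (real n * (real n * real n)) (rset 1 0 \<epsilon> s1))"
    have s2: "env s2" "imem s2 34 0 = 1" "rmem s2 2 0 = real n * (real n * real n)" "rmem s2 1 0 = \<epsilon>"
      using env1 by (auto simp: s2_def)
    have "runs (While (RLess (RGet 1 (INum 0)) (RNat (INum 1))) ?body) s2 ?Q"
    proof (rule runs_While[where N = m and I = "\<lambda>k s'. k \<le> m \<and> rmem s' 1 0 = \<epsilon> * 2 ^ k \<and>
        imem s' 34 0 = Suc k \<and> rmem s' 2 0 = real (n ^ (3 * Suc k))"])
      show "0 \<le> m \<and> rmem s2 1 0 = \<epsilon> * 2 ^ 0 \<and> imem s2 34 0 = Suc 0 \<and> rmem s2 2 0 = real (n ^ (3 * Suc 0))"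
        using s2 by (simp add: power3_eq_cube)
      fix k s3 assume ag3: "agree ?body s2 s3" and I: "k \<le> m \<and> rmem s3 1 0 = \<epsilon> * 2 ^ k \<and>
        imem s3 34 0 = Suc k \<and> rmem s3 2 0 = real (n ^ (3 * Suc k))"
      have env3: "env s3" by (rule env_agree[OF s2(1) ag3]) simp
      {
        assume "bval n f (RLess (RGet 1 (INum 0)) (RNat (INum 1))) s3"
        then have "k \<noteq> m" using I m(1) by auto
        then have k: "k < m" using I by simp
        show "k < m \<and> runs ?body s3 (\<lambda>s'. Suc k \<le> m \<and> rmem s' 1 0 = \<epsilon> * 2 ^ Suc k \<and>
            imem s' 34 0 = Suc (Suc k) \<and> rmem s' 2 0 = real (n ^ (3 * Suc (Suc k))))"
          using k I env_0[OF env3] power6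
          by (intro conjI runs_Seq runs_RSet runs_ISet) (simp_all add: power_add power3_eq_cube)
      next
        assume "\<not> bval n f (RLess (RGet 1 (INum 0)) (RNat (INum 1))) s3"
        then have "k = m" using I m(2)[of k] by force
        then show "?Q s3" using I env3 by simp
      }
    qed (rule m)
    moreover have "imem s1 0 0 = n" "rmem s1 0 0 = \<epsilon>"
      using ag1 by (auto simp: agree_def input_state_def)
    ultimately show "runs (Seq (RSet 1 (INum 0) (RGet 0 (INum 0)))
       (Seq (RSet 2 (INum 0) (RMul (RNat (V 0)) (RMul (RNat (V 0)) (RNat (V 0)))))
       (Seq (set_var 34 (INum 1)) (While (RLess (RGet 1 (INum 0)) (RNat (INum 1))) ?body)))) s1 ?Q"
      unfolding s2_def by (intro runs_Seq runs_RSet runs_ISet) simp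
  qed
qed

text \<open>Cell 0 of array 26 means something only after a suitable neighbour has been scanned, so
  the loop invariant is an implication; \<open>stable_next\<close> supplies its premise at the
  end.\<close>

lemma next_com_runs:
  assumes "env s" and Z: "stable (aset s 9)" "imem s 23 0 = cur" "cur \<in> aset s 9" "imem s 24 0 = prev"
  shows "runs next_com s (\<lambda>s'. imem s' 26 0 \<in> aset s 9 \<and> adj cur (imem s' 26 0) \<and> imem s' 26 0 \<noteq> prev)"
  unfolding next_com_def
proof (rule runs_FOR[where N = n and I = "\<lambda>k s'. (\<exists>w<k. w \<in> aset s 9 \<and> adj cur w \<and> w \<noteq> prev) \<longrightarrow>
    imem s' 26 0 \<in> aset s 9 \<and> adj cur (imem s' 26 0) \<and> imem s' 26 0 \<noteq> prev"])
  let ?b = "BAnd (BAnd (pos (IGet 9 (V 22))) (pos (entry 1 (V 23) (V 22))))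
         (BNot (BAnd (BNot (ILess (V 22) (V 24))) (BNot (ILess (V 24) (V 22)))))"
  let ?body = "If ?b (set_var 26 (V 22)) Skip"
  fix k s1 assume k: "k < n" and ag: "agree (FOR 22 (V 0) ?body) s s1" and 22: "imem s1 22 0 = k"
    and I: "(\<exists>w<k. w \<in> aset s 9 \<and> adj cur w \<and> w \<noteq> prev) \<longrightarrow>
      imem s1 26 0 \<in> aset s 9 \<and> adj cur (imem s1 26 0) \<and> imem s1 26 0 \<noteq> prev"
  have env: "env s1" by (rule env_agree[OF assms(1) ag]) simp
  have cur: "cur < n" using Z(3) aset_subset by blast
  have "imem s1 23 0 = cur" "imem s1 24 0 = prev" "imem s1 9 = imem s 9"
    using ag Z by (auto simp: agree_def)
  then have b: "bval n f ?b s1 \<longleftrightarrow> k \<in> aset s 9 \<and> adj cur k \<and> k \<noteq> prev"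
    using k cur 22 env_1[OF env cur k] env_3[OF env cur] by (auto simp: aset_def)
  show "runs ?body s1 (\<lambda>s'. (\<exists>w<Suc k. w \<in> aset s 9 \<and> adj cur w \<and> w \<noteq> prev) \<longrightarrow>
      imem (iset 22 0 (Suc k) s') 26 0 \<in> aset s 9 \<and> adj cur (imem (iset 22 0 (Suc k) s') 26 0) \<and>
      imem (iset 22 0 (Suc k) s') 26 0 \<noteq> prev)"
    by (rule runs_If; unfold b; intro runs_ISet runs_Skip) (use I 22 in \<open>auto simp: less_Suc_eq\<close>)
next
  fix s1 assume "(\<exists>w<n. w \<in> aset s 9 \<and> adj cur w \<and> w \<noteq> prev) \<longrightarrow>
      imem s1 26 0 \<in> aset s 9 \<and> adj cur (imem s1 26 0) \<and> imem s1 26 0 \<noteq> prev"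
  then show "imem s1 26 0 \<in> aset s 9 \<and> adj cur (imem s1 26 0) \<and> imem s1 26 0 \<noteq> prev"
    using stable_next[OF Z(1,3), of prev] adj_lt(2) by blast
qed (use assms env_0 n_le_pow in \<open>auto simp: agree_def\<close>)

lemma walk_com_runs:
  assumes "env s" and Z: "stable Z" "Z \<noteq> {}" "aset s 9 = Z" and 12: "imem s 12 = (\<lambda>_. 0)"
  shows "runs walk_com s (\<lambda>s'. is_cycle G (output_list s') \<and> set (output_list s') \<subseteq> Z)"
proof -
  have Zn: "Z \<subseteq> {..<n}" using aset_subset Z(3) by blast
  let ?Q = "\<lambda>s'. is_cycle G (output_list s') \<and> set (output_list s') \<subseteq> Z"
  let ?start = "FOR 20 (V 0) (If (pos (IGet 9 (V 20))) (set_var 23 (V 20)) Skip)"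
  let ?body = "Seq (ISet 11 (V 25) (V 23)) (Seq (set_var 25 (IAdd (V 25) (INum 1)))
         (Seq (ISet 12 (V 23) (V 25)) (Seq next_com (Seq (set_var 24 (V 23)) (set_var 23 (V 26))))))"
  let ?copy = "FOR 20 (ISub (V 25) (V 27)) (ISet 2 (IAdd (V 20) (INum 1)) (IGet 11 (IAdd (V 27) (V 20))))"
  let ?out = "Seq (set_var 27 (ISub (IGet 12 (V 23)) (INum 1))) (Seq (set_var 2 (ISub (V 25) (V 27))) ?copy)"
  \<comment> \<open>The list \<open>W\<close> of visited vertices is a ghost variable that links
    arrays 11 and 12 to \<open>walk_inv\<close>.\<close>
  define I :: "nat \<Rightarrow> state \<Rightarrow> bool" where "I k s' \<longleftrightarrow> (\<exists>W. length W = k \<and> walk_inv Z W (imem s' 24 0) (imem s' 23 0) \<and> imem s' 25 0 = k \<and>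
     (\<forall>i<k. imem s' 11 i = W ! i \<and> imem s' 12 (W ! i) = Suc i) \<and>
     (\<forall>v. v \<notin> set W \<longrightarrow> imem s' 12 v = 0))" for k s'
  have start: "runs ?start s (\<lambda>s'. imem s' 23 0 \<in> Z)"
  proof (rule runs_FOR[where N = n and I = "\<lambda>k s'. (\<exists>v<k. v \<in> Z) \<longrightarrow> imem s' 23 0 \<in> Z"])
    fix s1 assume "(\<exists>v<n. v \<in> Z) \<longrightarrow> imem s1 23 0 \<in> Z"
    then show "imem s1 23 0 \<in> Z" using Zn Z(2) by blast
  qed (use assms(1) env_0 n_le_pow in
      \<open>auto simp: agree_def aset_def less_Suc_eq Z(3)[symmetric] intro!: runs_If runs_ISet runs_Skip\<close>)
  have step: "k < n \<and> runs ?body s1 (I (Suc k))"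
    if env: "env s1" and Z1: "aset s1 9 = Z" and J: "I k s1" and b: "imem s1 12 (imem s1 23 0) = 0" for k s1
  proof -
    define prev cur where "prev = imem s1 24 0" and "cur = imem s1 23 0"
    obtain W where W: "length W = k" "walk_inv Z W prev cur" "imem s1 25 0 = k"
      "\<And>i. i < k \<Longrightarrow> imem s1 11 i = W ! i \<and> imem s1 12 (W ! i) = Suc i"
      "\<And>v. v \<notin> set W \<Longrightarrow> imem s1 12 v = 0"
      using J unfolding I_def prev_def cur_def by blast
    have new: "cur \<notin> set W"
      using W(1,4) b unfolding cur_def by (metis in_set_conv_nth nat.distinct(1))
    have ne: "W ! i \<noteq> cur" if "i < length W" for i
      using new that nth_mem by metis
    have curZ: "cur \<in> Z" using W(2) by (simp add: walk_inv_def)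
    define s2 where "s2 = iset 12 cur (Suc k) (iset 25 0 (Suc k) (iset 11 k cur s1))"
    have s2: "env s2" "stable (aset s2 9)" "imem s2 23 0 = cur" "cur \<in> aset s2 9" "imem s2 24 0 = prev"
      "aset s2 9 = Z"
      using env Z1 Z(1) curZ by (auto simp: s2_def cur_def prev_def)
    have rest: "runs (Seq next_com (Seq (set_var 24 (V 23)) (set_var 23 (V 26)))) s2 (I (Suc k))"
    proof (rule runs_Seq, rule runs_conseq[OF next_com_runs[OF s2(1-5)]])
      fix s3 assume ag: "agree next_com s2 s3"
        and "imem s3 26 0 \<in> aset s2 9 \<and> adj cur (imem s3 26 0) \<and> imem s3 26 0 \<noteq> prev"
      then have walk: "walk_inv Z (W @ [cur]) cur (imem s3 26 0)"
        using s2(6) by (intro walk_inv_step[OF W(2) new]) auto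
      have s3: "imem s3 23 0 = cur" "imem s3 25 0 = Suc k"
        "imem s3 11 = (imem s1 11)(k := cur)" "imem s3 12 = (imem s1 12)(cur := Suc k)"
        using ag by (auto simp: agree_def s2_def cur_def)
      have "I (Suc k) (iset 23 0 (imem s3 26 0) (iset 24 0 cur s3))"
        unfolding I_def
        by (rule exI[of _ "W @ [cur]"])
          (use W new ne walk s3 in \<open>auto simp: nth_append less_Suc_eq\<close>)
      then show "runs (Seq (set_var 24 (V 23)) (set_var 23 (V 26))) s3 (I (Suc k))"
        by (intro runs_Seq runs_ISet) (simp add: s3)
    qed
    have "runs ?body s1 (I (Suc k))"
      by (rule runs_Seq, rule runs_ISet, rule runs_Seq, rule runs_ISet, rule runs_Seq, rule runs_ISet)
        (use rest in \<open>simp add: s2_def W(3) cur_def\<close>)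
    moreover have "k < n"
      using walk_inv_length[OF Zn W(2) new] W(1) by simp
    ultimately show ?thesis by blast
  qed
  have out: "runs ?out s1 ?Q"
    if env: "env s1" and J: "I k s1" and b: "0 < imem s1 12 (imem s1 23 0)" for k s1
  proof -
    obtain W where W: "length W = k" "walk_inv Z W (imem s1 24 0) (imem s1 23 0)" "imem s1 25 0 = k"
      "\<And>i. i < k \<Longrightarrow> imem s1 11 i = W ! i \<and> imem s1 12 (W ! i) = Suc i"
      "\<And>v. v \<notin> set W \<Longrightarrow> imem s1 12 v = 0"
      using J unfolding I_def by blast
    have "imem s1 23 0 \<in> set W" using W(5) b by fastforce
    then obtain j where j: "j < length W" "W ! j = imem s1 23 0"
      by (metis in_set_conv_nth)
    have 12: "imem s1 12 (imem s1 23 0) = Suc j"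
      using W(1,4) j by metis
    have "k \<le> n"
    proof -
      have "distinct W" "set W \<subseteq> {..<n}" using W(2) Zn by (auto simp: walk_inv_def)
      then show ?thesis
        using card_mono[of "{..<n}" "set W"] W(1) by (simp add: distinct_card)
    qed
    define s2 where "s2 = iset 2 0 (k - j) (iset 27 0 j s1)"
    have "runs ?copy s2 ?Q"
    proof (rule runs_FOR[where N = "k - j" and
          I = "\<lambda>m s'. imem s' 2 0 = k - j \<and> (\<forall>i<m. imem s' 2 (Suc i) = W ! (j + i))"])
      fix s3 :: state assume I: "imem s3 2 0 = k - j \<and> (\<forall>i<k - j. imem s3 2 (Suc i) = W ! (j + i))"
      have "output_list s3 = map (imem s3 2) (map Suc [0..<k - j])"
        using I by (simp only: output_list_def map_Suc_upt One_nat_def)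
      also have "\<dots> = drop j W"
        by (rule nth_equalityI) (use I W(1) j(1) in auto)
      finally have "output_list s3 = drop j W" .
      then show "?Q s3" using walk_inv_cycle[OF W(2) j] by simp
    next
      show "k - j \<le> n ^ a" using \<open>k \<le> n\<close> n_le_pow by linarith
    qed (use W(3,4) in \<open>auto simp: agree_def s2_def W(1) less_Suc_eq intro!: runs_ISet\<close>)
    then show ?thesis
      by (intro runs_Seq runs_ISet) (simp add: s2_def 12 W(3))
  qed
  show ?thesis
    unfolding walk_com_def
  proof (rule runs_Seq, rule runs_conseq[OF start])
    fix s1 assume ag1: "agree ?start s s1" and 23: "imem s1 23 0 \<in> Z"
    have env1: "env s1" by (rule env_agree[OF assms(1) ag1]) simp
    define s2 where "s2 = iset 25 0 0 (iset 24 0 (imem s1 23 0) s1)"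
    have s2: "env s2" "aset s2 9 = Z"
      using env1 aset_agree[OF ag1, of 9] Z(3) by (simp_all add: s2_def)
    have I0: "I 0 s2"
      using 23 12 ag1 by (auto simp: I_def s2_def walk_inv_def agree_def)
    have "runs (Seq (While (BNot (pos (IGet 12 (V 23)))) ?body) ?out) s2 ?Q"
    proof (rule runs_Seq, rule runs_While[where N = n and I = I])
      fix k s3 assume ag: "agree ?body s2 s3" and J: "I k s3"
      have env: "env s3" by (rule env_agree[OF s2(1) ag]) simp
      have "aset s3 9 = Z" using aset_agree[OF ag, of 9] s2(2) by simp
      note step = step[OF env this J]
      {
        assume "bval n f (BNot (pos (IGet 12 (V 23)))) s3"
        then show "k < n \<and> runs ?body s3 (I (Suc k))" by (intro step) simp
      next
        assume "\<not> bval n f (BNot (pos (IGet 12 (V 23)))) s3"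
        then show "runs ?out s3 ?Q" by (intro out[OF env J]) simp
      }
    qed (use I0 n_le_pow in simp_all)
    then show "runs (Seq (set_var 24 (V 23)) (Seq (set_var 25 (INum 0))
        (Seq (While (BNot (pos (IGet 12 (V 23)))) ?body) ?out))) s1 ?Q"
      unfolding s2_def by (intro runs_Seq[of "set_var 24 _"] runs_Seq[of "set_var 25 _"] runs_ISet) simp
  qed
qed

lemma cycle_com_runs:
  assumes cycle: "\<exists>C. is_cycle G C" and \<epsilon>: "0 < \<epsilon>"
    and m: "1 \<le> \<epsilon> * 2 ^ m" "\<And>k. k < m \<Longrightarrow> \<epsilon> * 2 ^ k < 1" and a: "a = 3 * Suc m"
  shows "runs cycle_com (input_state n G \<epsilon>)
    (\<lambda>s. is_cycle G (output_list s) \<and> f (set (output_list s)) \<le> (1 + \<epsilon>) * OPT G f)"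
proof -
  let ?Q = "\<lambda>s. is_cycle G (output_list s) \<and> f (set (output_list s)) \<le> (1 + \<epsilon>) * OPT G f"
  let ?s = "input_state n G \<epsilon>" and ?N = "n ^ (3 * Suc m)"
  have fin: "finite ((\<lambda>C. f (set C)) ` {C. is_cycle G C})"
    using finite_cycles[OF pair_graph] by simp
  have "OPT G f \<in> (\<lambda>C. f (set C)) ` {C. is_cycle G C}"
    unfolding OPT_def using cycle by (intro Min_in[OF fin]) auto
  then obtain C where C: "is_cycle G C" "f (set C) = OPT G f" by auto
  obtain x B where xB: "C = [] @ x # B"
    using is_cycleD(1)[OF C(1)] by (cases C) auto
  have "0 \<le> f {x}" "0 \<le> OPT G f"
    using f_nonneg[of "{x}"] f_nonneg[of "set C"] is_cycleD(3)[OF C(1)] C(2) xB by auto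
  define r where "r = f (set ([] @ x # B)) - f (set ([] @ [x]))"
  obtain c where c: "c < ?N" "has_cycle (run (Suc m) c {})" "run (Suc m) c {} \<subseteq> {..<n}"
    "f (run (Suc m) c {}) \<le> OPT G f + r / 2 ^ m"
    using run_finds_cycle[OF C(1)[unfolded xB] _ r_def, of "{}" m] C(2) unfolding xB by auto
  \<comment> \<open>Nonnegativity of \<open>f {x}\<close> bounds the cost missing at the start by
    \<open>OPT G f\<close>, turning the additive error \<open>r / 2 ^ m\<close> into a relative
    one.\<close>
  have "r \<le> OPT G f"
    using \<open>0 \<le> f {x}\<close> C(2) by (simp add: r_def xB)
  then have "r / 2 ^ m \<le> OPT G f / 2 ^ m" by (simp add: divide_right_mono)
  also have "\<dots> = OPT G f * 1 / 2 ^ m" by simp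
  also have "\<dots> \<le> OPT G f * (\<epsilon> * 2 ^ m) / 2 ^ m"
    using m(1) \<open>0 \<le> OPT G f\<close> by (intro divide_right_mono mult_left_mono) auto
  finally have run_le: "f (run (Suc m) c {}) \<le> (1 + \<epsilon>) * OPT G f"
    using c(4) by (simp add: algebra_simps)
  let ?Y = "core (run (Suc m) c {})"
  obtain C' where C': "is_cycle G C'" "set C' \<subseteq> run (Suc m) c {}"
    using c(2) unfolding has_cycle_def by blast
  have "set C' \<subseteq> ?Y" by (rule cycle_subset_core[OF C' c(3)])
  moreover have "set C' \<noteq> {}" using is_cycleD(1)[OF C'(1)] by auto
  ultimately have Y: "?Y \<noteq> {}" "?Y \<subseteq> run (Suc m) c {}"
    using core_props(1)[OF c(3)] by auto
  have core_le: "f ?Y \<le> (1 + \<epsilon>) * OPT G f"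
    using f_mono[OF Y(2) c(3)] run_le by linarith
  have stable: "stable (core (run (Suc m) c' {}))" for c'
    using run_subset[of "{}" "Suc m" c'] n3 by (intro core_props(2)) auto
  have small: "m \<le> n ^ a" "Suc m \<le> n ^ a" "?N \<le> n ^ a"
    using le_power_n[of a] by (auto simp: a)
  have init: "runs init_com ?s (\<lambda>s. env s \<and> imem s 34 0 = Suc m \<and> rmem s 2 0 = real ?N)"
    by (rule init_com_runs) (use m small in auto)
  show ?thesis
    unfolding cycle_com_def
  proof (rule runs_Seq, rule runs_conseq[OF init], rule runs_Seq)
    fix s1 assume ag1: "agree init_com ?s s1"
      and s1: "env s1 \<and> imem s1 34 0 = Suc m \<and> rmem s1 2 0 = real ?N"
    then have env1: "env s1" and vals: "imem s1 34 0 = Suc m" "rmem s1 2 0 = real ?N" by auto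
    have zero: "rmem s1 4 0 = 0" "imem s1 12 = (\<lambda>_. 0)"
      using ag1 by (auto simp: agree_def input_state_def)
    show "runs search_com s1 (\<lambda>s'. runs walk_com s' ?Q)"
    proof (rule runs_conseq[OF search_com_runs[OF env1 vals(1) small(2) vals(2) small(3) zero(1) stable]])
      fix s2 assume ag2: "agree search_com s1 s2" and best: "best (Suc m) ?N s2"
      have env2: "env s2" by (rule env_agree[OF env1 ag2]) simp
      have ge: "score ?Y \<le> rmem s2 4 0"
        using best c(1) Y(1) by (simp add: best_def)
      have Yn: "?Y \<subseteq> {..<n}" using Y(2) c(3) by blast
      \<comment> \<open>The record is at least the positive score of the good code's core, hence not
        the initial 0.\<close>
      have Z: "aset s2 9 \<noteq> {}" "stable (aset s2 9)" "rmem s2 4 0 = score (aset s2 9)"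
        using best ge score_pos[OF Yn] by (auto simp: best_def)
      have "f (aset s2 9) \<le> f ?Y"
        using ge Z(3) score_le_iff[OF Yn aset_subset] by simp
      then have Zle: "f (aset s2 9) \<le> (1 + \<epsilon>) * OPT G f"
        using core_le by linarith
      have zero2: "imem s2 12 = (\<lambda>_. 0)"
        using ag2 zero(2) by (simp add: agree_def)
      show "runs walk_com s2 ?Q"
      proof (rule runs_conseq[OF walk_com_runs[OF env2 Z(2,1) refl zero2]])
        fix s3 assume 3: "is_cycle G (output_list s3) \<and> set (output_list s3) \<subseteq> aset s2 9"
        then have "f (set (output_list s3)) \<le> f (aset s2 9)"
          by (intro f_mono aset_subset) simp
        then show "?Q s3"
          using 3 Zle by simp
      qed
    qed
  qed
qed

end

theorem theorem1:
  shows "\<exists>(P :: com) (c :: real). \<forall>(n :: nat) (G :: nat pair_pre_digraph)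
      (f :: nat set \<Rightarrow> real) (\<epsilon> :: real).
    pair_graph G \<and> pverts G = {..<n} \<and> (\<exists>C. is_cycle G C) \<and> \<epsilon> > 0 \<and>
    submodular_on (pverts G) f \<and> mono_on (Pow (pverts G)) f \<and>
    (\<forall>X \<subseteq> pverts G. f X \<ge> 0) \<longrightarrow>
    (\<exists>t s. exec n f P (input_state n G \<epsilon>) t s \<and>
       is_cycle G (output_list s) \<and>
       f (set (output_list s)) \<le> (1 + \<epsilon>) * OPT G f \<and>
       real t \<le> real n powr (c * max 1 (log 2 (1 / \<epsilon>))))"
proof (intro exI[of _ cycle_com] exI[of _ "9 * real (cexp 1 cycle_com)"] allI impI)
  fix n G and f :: "nat set \<Rightarrow> real" and \<epsilon> :: real
  assume asm: "pair_graph G \<and> pverts G = {..<n} \<and> (\<exists>C. is_cycle G C) \<and> \<epsilon> > 0 \<and>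
    submodular_on (pverts G) f \<and> mono_on (Pow (pverts G)) f \<and> (\<forall>X \<subseteq> pverts G. f X \<ge> 0)"
  then have \<epsilon>: "0 < \<epsilon>" and cycle: "\<exists>C. is_cycle G C" by auto
  interpret submodular_graph n G f
    by (rule submodular_graph.intro) (use asm in blast)+
  obtain C where C: "is_cycle G C" using cycle by blast
  have "3 \<le> card (set C)" "set C \<subseteq> {..<n}"
    using is_cycleD[OF C] by (simp_all add: distinct_card)
  then have n3: "3 \<le> n"
    using card_mono[of "{..<n}" "set C"] by simp
  define m where "m = (LEAST m. 1 \<le> \<epsilon> * 2 ^ m)"
  obtain k where "1 / \<epsilon> < 2 ^ k"
    using real_arch_pow[of 2 "1 / \<epsilon>"] by auto
  then have "1 \<le> \<epsilon> * 2 ^ k" using \<epsilon> by (simp add: field_simps)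
  then have m: "1 \<le> \<epsilon> * 2 ^ m" unfolding m_def by (rule LeastI)
  have m': "\<epsilon> * 2 ^ k < 1" if "k < m" for k
    using not_less_Least[OF that[unfolded m_def]] by simp
  define M where "M = max 1 (log 2 (1 / \<epsilon>))"
  \<comment> \<open>By minimality \<open>m < log 2 (1 / \<epsilon>) + 1\<close> unless
    \<open>m = 0\<close>, and \<open>M \<ge> 1\<close> absorbs the added 1. The same absorption
    gives \<open>3 * Suc m \<le> 9 * M\<close>, the origin of the factor 9.\<close>
  have "real m \<le> 2 * M"
  proof (cases m)
    case 0
    then show ?thesis by (simp add: M_def)
  next
    case (Suc k)
    have "2 ^ k < 1 / \<epsilon>" using m'[of k] Suc \<epsilon> by (simp add: field_simps)
    then have "real k < log 2 (1 / \<epsilon>)"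
      using \<epsilon> by (simp add: less_log_iff powr_realpow)
    then show ?thesis using Suc by (simp add: M_def)
  qed
  then have a_le: "real (3 * Suc m) \<le> 9 * M"
    by (simp add: M_def)
  interpret bounded_machine n G f "3 * Suc m"
    using n3 by unfold_locales auto
  have "runs cycle_com (input_state n G \<epsilon>)
      (\<lambda>s. is_cycle G (output_list s) \<and> f (set (output_list s)) \<le> (1 + \<epsilon>) * OPT G f)"
    by (rule cycle_com_runs[OF cycle \<epsilon> m]) (simp_all add: m')
  then obtain t s where t: "exec n f cycle_com (input_state n G \<epsilon>) t s" "t \<le> n ^ cexp (3 * Suc m) cycle_com"
    "is_cycle G (output_list s)" "f (set (output_list s)) \<le> (1 + \<epsilon>) * OPT G f"
    unfolding runs_def by blast
  have "real t \<le> real n powr real (cexp (3 * Suc m) cycle_com)"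
    using t(2) n3 by (simp add: powr_realpow flip: of_nat_power)
  also have "\<dots> \<le> real n powr (9 * real (cexp 1 cycle_com) * M)"
  proof (rule powr_mono)
    have "real (cexp (3 * Suc m) cycle_com) \<le> real (cexp 1 cycle_com) * real (3 * Suc m)"
      unfolding of_nat_mult[symmetric] of_nat_le_iff by (rule cexp_linear) simp
    also have "\<dots> \<le> real (cexp 1 cycle_com) * (9 * M)"
      by (intro mult_left_mono a_le) simp
    finally show "real (cexp (3 * Suc m) cycle_com) \<le> 9 * real (cexp 1 cycle_com) * M"
      by (simp add: ac_simps)
  qed (use n3 in simp)
  finally show "\<exists>t s. exec n f cycle_com (input_state n G \<epsilon>) t s \<and>
       is_cycle G (output_list s) \<and>
       f (set (output_list s)) \<le> (1 + \<epsilon>) * OPT G f \<and>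
       real t \<le> real n powr (9 * real (cexp 1 cycle_com) * max 1 (log 2 (1 / \<epsilon>)))"
    using t unfolding M_def by blast
qed

end
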